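(* Let $(A,G,\sigma)$ be a skew category system with $A$ commutative, and let $A \rtimes^{\sigma} G$ be the associated skew category algebra. Consider the following six assertions: (i) $A \rtimes^{\sigma} G$ is simple; (ii) $G$ is inverse connected; (iii) for each $e \in \mathrm{ob}(G)$, the ring $A_e$ is $G_e$-simple; (iv) for each $e \in \mathrm{ob}(G)$, the ring $Z(A_e \rtimes^{\sigma} G_e)$ is a field; (v) $\ker(\sigma)$ is locally trivial; (vi) $A$ is maximal commutative in $A \rtimes^{\sigma} G$. The following conclusions hold: (a) (i) implies each of (ii), (iii), (iv), (v) and (vi); (b) if $G$ is a groupoid, then (i) holds if and only if (ii), (iii), (iv), (v) and (vi) all hold.
   Context: For a small category $G$: $\mathrm{ob}(G)$ is its set of objects and $\mathrm{mor}(G)$ its set of morphisms; $n \in G$ means $n \in \mathrm{mor}(G)$. An object is identified with its identity morphism. The domain and codomain of a morphism $n$ are $d(n)$ and $c(n)$; the product $mn$ is defined exactly when $d(m)=c(n)$, and $G^{(2)}$ is the set of such composable pairs $(m,n)$. For $e \in \mathrm{ob}(G)$, $G_e$ is the monoid of all $n$ with $d(n)=c(n)=e$. A groupoid is a category all of whose morphisms are isomorphisms. $G$ is inverse connected if for all $e,f \in \mathrm{ob}(G)$ there are $m,n \in \mathrm{mor}(G)$ with $d(m)=c(n)=f$ and $mn=e$ (the identity of $e$). Rings are associative; unital rings have nonzero identity, and homomorphisms between unital rings preserve identities. $\mathrm{Ring}$ is the category of unital rings. Ideals are two-sided; a nontrivial ideal is one that is proper and nonzero. A ring is simple if it has no nontrivial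 ideal. $Z(R)$ is the center of $R$. A commutative subring $B$ of a ring $R$ is maximal commutative in $R$ if the commutant of $B$ in $R$ (the set of elements of $R$ commuting with every element of $B$) equals $B$. A skew category system is a triple $(A,G,\sigma)$ where $G$ is a small category, $A = \bigoplus_{e \in \mathrm{ob}(G)} A_e$ is a direct sum of unital rings $A_e$, and $\sigma : G \to \mathrm{Ring}$ is a functor with $\sigma(n) : A_{d(n)} \to A_{c(n)}$ for $n \in G$; so $\sigma(e)=\mathrm{id}_{A_e}$ for $e \in \mathrm{ob}(G)$ and $\sigma(m)\sigma(n)=\sigma(mn)$ for $(m,n)\in G^{(2)}$. The skew category algebra $A \rtimes^{\sigma} G$ is the set of formal sums $\sum_{n \in G} a_n u_n$ with $a_n \in A_{c(n)}$, all but finitely many $a_n$ being zero, with componentwise addition and multiplication determined biadditively by $(a u_m)(b u_n) = a\,\sigma(m)(b)\, u_{mn}$ if $(m,n) \in G^{(2)}$ and $(a u_m)(b u_n) = 0$ otherwise. It is an associative ring, not necessarily unital. $A$ is regarded as a subring of $A \rtimes^{\sigma} G$ by identifying $A_e$ with $A_e u_e$ for each $e \in \mathrm{ob}(G)$. $A_e \rtimes^{\sigma} G_e$ is the skew category algebra of the one-object category $G_e$ acting on $A_e$ by restriction of $\sigma$. $A_e$ is $G_e$-simple if there is no nontrivial ideal $J$ of $A_e$ with $\sigma(n)(J) \subseteq J$ for all $n \in G_e$. $\ker(\sigma)$ is locally trivial if for each $e \in \mathrm{ob}(G)$ and all $m,n \in G_e$, $\sigma(m)=\sigma(n)$ implies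 $m=n$. *)

theory Defs
  imports "HOL-Algebra.Ideal"
begin

text \<open>
  Objects are identified with their identity morphisms, so the objects form a
  subset of the morphisms. Only the values of \<open>dom_of\<close>, \<open>cod_of\<close> on morphisms and of
  \<open>ccomp\<close> on composable pairs are meaningful.
\<close>

record 'm category =
  mor :: "'m set"
  ob :: "'m set"
  dom_of :: "'m \<Rightarrow> 'm"
  cod_of :: "'m \<Rightarrow> 'm"
  ccomp :: "'m \<Rightarrow> 'm \<Rightarrow> 'm"

definition composable :: "'m category \<Rightarrow> ('m \<times> 'm) set" where
  "composable G = {(m, n). m \<in> mor G \<and> n \<in> mor G \<and> dom_of G m = cod_of G n}"

locale small_category =
  fixes G :: "'m category"
  assumes ob_mor: "ob G \<subseteq> mor G"
    and dom_ob: "n \<in> mor G \<Longrightarrow> dom_of G n \<in> ob G"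
    and cod_ob: "n \<in> mor G \<Longrightarrow> cod_of G n \<in> ob G"
    and ident_dom: "e \<in> ob G \<Longrightarrow> dom_of G e = e"
    and ident_cod: "e \<in> ob G \<Longrightarrow> cod_of G e = e"
    and comp_mor: "(m, n) \<in> composable G \<Longrightarrow> ccomp G m n \<in> mor G"
    and dom_comp: "(m, n) \<in> composable G \<Longrightarrow> dom_of G (ccomp G m n) = dom_of G n"
    and cod_comp: "(m, n) \<in> composable G \<Longrightarrow> cod_of G (ccomp G m n) = cod_of G m"
    and ident_left: "n \<in> mor G \<Longrightarrow> ccomp G (cod_of G n) n = n"
    and ident_right: "n \<in> mor G \<Longrightarrow> ccomp G n (dom_of G n) = n"
    and comp_assoc: "\<lbrakk>(l, m) \<in> composable G; (m, n) \<in> composable G\<rbrakk>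
      \<Longrightarrow> ccomp G (ccomp G l m) n = ccomp G l (ccomp G m n)"

text \<open>The monoid of endomorphisms of \<open>e\<close>, as a category with the single object \<open>e\<close>.\<close>

definition vertex_monoid :: "'m category \<Rightarrow> 'm \<Rightarrow> 'm category" where
  "vertex_monoid G e =
     G\<lparr>mor := {n \<in> mor G. dom_of G n = e \<and> cod_of G n = e}, ob := {e}\<rparr>"

definition groupoid :: "'m category \<Rightarrow> bool" where
  "groupoid G \<longleftrightarrow> (\<forall>n\<in>mor G. \<exists>m\<in>mor G. dom_of G m = cod_of G n \<and> cod_of G m = dom_of G n
     \<and> ccomp G m n = dom_of G n \<and> ccomp G n m = cod_of G n)"

definition inverse_connected :: "'m category \<Rightarrow> bool" where
  "inverse_connected G \<longleftrightarrow> (\<forall>e\<in>ob G. \<forall>f\<in>ob G. \<exists>m\<in>mor G. \<exists>n\<in>mor G.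
     dom_of G m = f \<and> cod_of G n = f \<and> ccomp G m n = e)"

text \<open>
  The library's \<^locale>\<open>ideal\<close> presupposes a unital ring. The notions below never refer to
  the \<open>one\<close> field of the record and so also apply to rings without identity.
\<close>

definition two_sided_ideal :: "'a set \<Rightarrow> ('a, 'r) ring_scheme \<Rightarrow> bool" where
  "two_sided_ideal I R \<longleftrightarrow> additive_subgroup I R \<and>
     (\<forall>a\<in>I. \<forall>x\<in>carrier R. x \<otimes>\<^bsub>R\<^esub> a \<in> I \<and> a \<otimes>\<^bsub>R\<^esub> x \<in> I)"

lemma two_sided_ideal_iff_ideal:
  assumes "ring R"
  shows "two_sided_ideal I R \<longleftrightarrow> ideal I R"
  using assms
  by (auto simp: two_sided_ideal_def ideal_def ideal_axioms_def)

definition nontrivial_ideal :: "'a set \<Rightarrow> ('a, 'r) ring_scheme \<Rightarrow> bool" where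
  "nontrivial_ideal I R \<longleftrightarrow> two_sided_ideal I R \<and> I \<noteq> carrier R \<and> I \<noteq> {\<zero>\<^bsub>R\<^esub>}"

definition simple_ring :: "('a, 'r) ring_scheme \<Rightarrow> bool" where
  "simple_ring R \<longleftrightarrow> \<not> (\<exists>I. nontrivial_ideal I R)"

definition commutative_ring :: "('a, 'r) ring_scheme \<Rightarrow> bool" where
  "commutative_ring R \<longleftrightarrow> (\<forall>x\<in>carrier R. \<forall>y\<in>carrier R. x \<otimes>\<^bsub>R\<^esub> y = y \<otimes>\<^bsub>R\<^esub> x)"

definition commutant :: "'a set \<Rightarrow> ('a, 'r) ring_scheme \<Rightarrow> 'a set" where
  "commutant B R = {x \<in> carrier R. \<forall>b\<in>B. x \<otimes>\<^bsub>R\<^esub> b = b \<otimes>\<^bsub>R\<^esub> x}"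

text \<open>The equation below already forces \<open>B\<close> to be a commutative subring.\<close>

definition maximal_commutative :: "'a set \<Rightarrow> ('a, 'r) ring_scheme \<Rightarrow> bool" where
  "maximal_commutative B R \<longleftrightarrow> commutant B R = B"

definition center_ring :: "('a, 'r) ring_scheme \<Rightarrow> ('a, 'r) ring_scheme" where
  "center_ring R = R\<lparr>carrier := commutant (carrier R) R\<rparr>"

text \<open>
  The functor into unital rings is the object map \<open>A\<close> together with the morphism map \<open>\<sigma>\<close>;
  \<open>A e\<close> matters only for objects \<open>e\<close>, and \<open>\<sigma> n\<close> only on the carrier of \<open>A (dom_of G n)\<close>.
  Equality of values of \<open>\<sigma>\<close> must accordingly be tested on carriers.
\<close>

locale skew_category_system = small_category G
  for A :: "'m \<Rightarrow> ('a, 'r) ring_scheme"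
    and G :: "'m category"
    and \<sigma> :: "'m \<Rightarrow> 'a \<Rightarrow> 'a" +
  assumes ring_A: "e \<in> ob G \<Longrightarrow> ring (A e)"
    and one_not_zero_A: "e \<in> ob G \<Longrightarrow> \<one>\<^bsub>A e\<^esub> \<noteq> \<zero>\<^bsub>A e\<^esub>"
    and sigma_hom: "n \<in> mor G \<Longrightarrow> \<sigma> n \<in> ring_hom (A (dom_of G n)) (A (cod_of G n))"
    and sigma_ident: "\<lbrakk>e \<in> ob G; a \<in> carrier (A e)\<rbrakk> \<Longrightarrow> \<sigma> e a = a"
    and sigma_comp: "\<lbrakk>(m, n) \<in> composable G; a \<in> carrier (A (dom_of G n))\<rbrakk>
      \<Longrightarrow> \<sigma> m (\<sigma> n a) = \<sigma> (ccomp G m n) a"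

text \<open>
  Elements of direct sums and of skew category algebras are finitely supported families, made
  extensional outside the index set so that equality is equality of functions. The \<open>one\<close>
  field is the identity when there are finitely many objects (or summands); otherwise it lies
  outside the carrier and plays no role.
\<close>

definition direct_sum :: "'i set \<Rightarrow> ('i \<Rightarrow> ('a, 'r) ring_scheme) \<Rightarrow> ('i \<Rightarrow> 'a) ring" where
  "direct_sum I A =
     \<lparr>carrier = {x \<in> (\<Pi>\<^sub>E i\<in>I. carrier (A i)). finite {i \<in> I. x i \<noteq> \<zero>\<^bsub>A i\<^esub>}},
      mult = (\<lambda>x y. \<lambda>i\<in>I. x i \<otimes>\<^bsub>A i\<^esub> y i),
      one = (\<lambda>i\<in>I. \<one>\<^bsub>A i\<^esub>),
      zero = (\<lambda>i\<in>I. \<zero>\<^bsub>A i\<^esub>),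
      add = (\<lambda>x y. \<lambda>i\<in>I. x i \<oplus>\<^bsub>A i\<^esub> y i)\<rparr>"

text \<open>
  The formal sum of the \<open>a\<^sub>n u\<^sub>n\<close> is the family \<open>n \<mapsto> a\<^sub>n\<close>. The coefficient of a product at
  \<open>p\<close> is a sum over the factorizations of \<open>p\<close>; these are restricted to the supports of the
  factors because \<^const>\<open>finsum\<close> over an infinite index set is zero by convention.
\<close>

definition skew_mult ::
  "('m \<Rightarrow> ('a, 'r) ring_scheme) \<Rightarrow> 'm category \<Rightarrow> ('m \<Rightarrow> 'a \<Rightarrow> 'a) \<Rightarrow>
   ('m \<Rightarrow> 'a) \<Rightarrow> ('m \<Rightarrow> 'a) \<Rightarrow> 'm \<Rightarrow> 'a" where
  "skew_mult A G \<sigma> x y = (\<lambda>p\<in>mor G.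
     finsum (A (cod_of G p)) (\<lambda>(m, n). x m \<otimes>\<^bsub>A (cod_of G p)\<^esub> \<sigma> m (y n))
       {(m, n) \<in> composable G. ccomp G m n = p \<and>
          x m \<noteq> \<zero>\<^bsub>A (cod_of G m)\<^esub> \<and> y n \<noteq> \<zero>\<^bsub>A (cod_of G n)\<^esub>})"

definition skew_category_algebra ::
  "('m \<Rightarrow> ('a, 'r) ring_scheme) \<Rightarrow> 'm category \<Rightarrow> ('m \<Rightarrow> 'a \<Rightarrow> 'a) \<Rightarrow> ('m \<Rightarrow> 'a) ring" where
  "skew_category_algebra A G \<sigma> =
     \<lparr>carrier = {x \<in> (\<Pi>\<^sub>E n\<in>mor G. carrier (A (cod_of G n))).
                   finite {n \<in> mor G. x n \<noteq> \<zero>\<^bsub>A (cod_of G n)\<^esub>}},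
      mult = skew_mult A G \<sigma>,
      one = (\<lambda>n\<in>mor G. if n \<in> ob G then \<one>\<^bsub>A n\<^esub> else \<zero>\<^bsub>A (cod_of G n)\<^esub>),
      zero = (\<lambda>n\<in>mor G. \<zero>\<^bsub>A (cod_of G n)\<^esub>),
      add = (\<lambda>x y. \<lambda>n\<in>mor G. x n \<oplus>\<^bsub>A (cod_of G n)\<^esub> y n)\<rparr>"

definition monomial ::
  "('m \<Rightarrow> ('a, 'r) ring_scheme) \<Rightarrow> 'm category \<Rightarrow> 'a \<Rightarrow> 'm \<Rightarrow> 'm \<Rightarrow> 'a" where
  "monomial A G a m = (\<lambda>n\<in>mor G. if n = m then a else \<zero>\<^bsub>A (cod_of G n)\<^esub>)"

lemma (in skew_category_system) monomial_mult:
  assumes m: "m \<in> mor G" and n: "n \<in> mor G"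
    and a: "a \<in> carrier (A (cod_of G m))" and b: "b \<in> carrier (A (cod_of G n))"
  shows "monomial A G a m \<otimes>\<^bsub>skew_category_algebra A G \<sigma>\<^esub> monomial A G b n =
    (if (m, n) \<in> composable G then monomial A G (a \<otimes>\<^bsub>A (cod_of G m)\<^esub> \<sigma> m b) (ccomp G m n)
     else \<zero>\<^bsub>skew_category_algebra A G \<sigma>\<^esub>)"
proof -
  let ?x = "monomial A G a m" and ?y = "monomial A G b n"
  have "skew_mult A G \<sigma> ?x ?y p =
      (if (m, n) \<in> composable G then monomial A G (a \<otimes>\<^bsub>A (cod_of G m)\<^esub> \<sigma> m b) (ccomp G m n)
       else \<zero>\<^bsub>skew_category_algebra A G \<sigma>\<^esub>) p" for p
  proof (cases "p \<in> mor G")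
    case False
    then show ?thesis
      by (auto simp: skew_mult_def monomial_def skew_category_algebra_def)
  next
    case p: True
    interpret R: ring "A (cod_of G p)"
      using p by (simp add: ring_A cod_ob)
    let ?S = "{(k, l) \<in> composable G. ccomp G k l = p \<and>
      ?x k \<noteq> \<zero>\<^bsub>A (cod_of G k)\<^esub> \<and> ?y l \<noteq> \<zero>\<^bsub>A (cod_of G l)\<^esub>}"
    have S: "?S = (if (m, n) \<in> composable G \<and> ccomp G m n = p \<and>
        a \<noteq> \<zero>\<^bsub>A (cod_of G m)\<^esub> \<and> b \<noteq> \<zero>\<^bsub>A (cod_of G n)\<^esub> then {(m, n)} else {})"
      using m n by (auto simp: monomial_def composable_def split: if_splits)
    have val: "skew_mult A G \<sigma> ?x ?y p =
        finsum (A (cod_of G p)) (\<lambda>(k, l). ?x k \<otimes>\<^bsub>A (cod_of G p)\<^esub> \<sigma> k (?y l)) ?S"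
      using p by (simp add: skew_mult_def)
    show ?thesis
    proof (cases "(m, n) \<in> composable G \<and> ccomp G m n = p")
      case False
      then show ?thesis
        using p unfolding val S by (auto simp: monomial_def skew_category_algebra_def)
    next
      case True
      then have cp: "cod_of G p = cod_of G m" and dm: "dom_of G m = cod_of G n"
        using cod_comp by (auto simp: composable_def)
      have hom: "\<sigma> m \<in> ring_hom (A (cod_of G n)) (A (cod_of G p))"
        using sigma_hom[OF m] by (simp add: cp dm)
      then have sb: "\<sigma> m b \<in> carrier (A (cod_of G p))"
        using b by (simp add: ring_hom_closed)
      have s0: "\<sigma> m \<zero>\<^bsub>A (cod_of G n)\<^esub> = \<zero>\<^bsub>A (cod_of G p)\<^esub>"
        using ring_hom_zero[OF hom] ring_A[OF cod_ob[OF n]] R.ring_axioms by blast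
      have a': "a \<in> carrier (A (cod_of G p))"
        using a by (simp add: cp)
      have "finsum (A (cod_of G p)) (\<lambda>(k, l). ?x k \<otimes>\<^bsub>A (cod_of G p)\<^esub> \<sigma> k (?y l)) ?S
          = a \<otimes>\<^bsub>A (cod_of G p)\<^esub> \<sigma> m b"
      proof (cases "a = \<zero>\<^bsub>A (cod_of G m)\<^esub> \<or> b = \<zero>\<^bsub>A (cod_of G n)\<^esub>")
        case zero: True
        interpret M: ring "A (cod_of G m)"
          using m by (simp add: ring_A cod_ob)
        from zero show ?thesis
          unfolding S using a' sb s0 by (auto simp: cp)
      next
        case False
        then have "?S = insert (m, n) {}"
          unfolding S using True by simp
        then show ?thesis
          using m n a' sb by (simp add: monomial_def R.finsum_insert del: insert_iff)
      qed
      then have "skew_mult A G \<sigma> ?x ?y p = a \<otimes>\<^bsub>A (cod_of G p)\<^esub> \<sigma> m b"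
        unfolding val .
      also have "\<dots> = monomial A G (a \<otimes>\<^bsub>A (cod_of G m)\<^esub> \<sigma> m b) (ccomp G m n) p"
        using True p by (simp add: monomial_def cp)
      finally show ?thesis
        using True by simp
    qed
  qed
  then show ?thesis
    by (auto simp: skew_category_algebra_def)
qed

text \<open>
  The copy of the direct sum \<open>A\<close> inside the skew category algebra: \<open>A e\<close> is identified with
  \<open>A e u\<^sub>e\<close> for each object \<open>e\<close>.
\<close>

definition base_embedding ::
  "('m \<Rightarrow> ('a, 'r) ring_scheme) \<Rightarrow> 'm category \<Rightarrow> ('m \<Rightarrow> 'a) \<Rightarrow> 'm \<Rightarrow> 'a" where
  "base_embedding A G x = (\<lambda>n\<in>mor G. if n \<in> ob G then x n else \<zero>\<^bsub>A (cod_of G n)\<^esub>)"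

definition base_subring ::
  "('m \<Rightarrow> ('a, 'r) ring_scheme) \<Rightarrow> 'm category \<Rightarrow> ('m \<Rightarrow> 'a) set" where
  "base_subring A G = base_embedding A G ` carrier (direct_sum (ob G) A)"

definition vertex_simple ::
  "('m \<Rightarrow> ('a, 'r) ring_scheme) \<Rightarrow> 'm category \<Rightarrow> ('m \<Rightarrow> 'a \<Rightarrow> 'a) \<Rightarrow> 'm \<Rightarrow> bool" where
  "vertex_simple A G \<sigma> e \<longleftrightarrow>
     \<not> (\<exists>J. nontrivial_ideal J (A e) \<and> (\<forall>n\<in>mor (vertex_monoid G e). \<sigma> n ` J \<subseteq> J))"

definition kernel_locally_trivial ::
  "('m \<Rightarrow> ('a, 'r) ring_scheme) \<Rightarrow> 'm category \<Rightarrow> ('m \<Rightarrow> 'a \<Rightarrow> 'a) \<Rightarrow> bool" where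
  "kernel_locally_trivial A G \<sigma> \<longleftrightarrow>
     (\<forall>e\<in>ob G. \<forall>m\<in>mor (vertex_monoid G e). \<forall>n\<in>mor (vertex_monoid G e).
        (\<forall>a\<in>carrier (A e). \<sigma> m a = \<sigma> n a) \<longrightarrow> m = n)"

end

theory Submission
  imports Defs "HOL-Algebra.Subrings"
begin

text \<open>
  Write \<open>a u\<^sub>n\<close> for the monomial with coefficient \<open>a\<close> at the morphism \<open>n\<close> (\<open>mon a n\<close> in the proofs),
  and \<open>G\<^sub>e\<close> for the endomorphism monoid of an object \<open>e\<close>.

  Each consequence of simplicity is proved by exhibiting an ideal. Rather than generating one and
  then computing its elements, one turns the matter round: for an additive subgroup \<open>K\<close> of the
  algebra, the set of all \<open>x\<close> with \<open>r x s \<in> K\<close> for all \<open>r\<close>, \<open>s\<close> is an ideal. If \<open>K\<close> misses \<open>u\<^sub>e\<close>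
  then so does this ideal, because \<open>u\<^sub>e u\<^sub>e u\<^sub>e = u\<^sub>e\<close>; hence in a simple algebra every \<open>w\<close> with
  \<open>r w s \<in> K\<close> for all \<open>r\<close>, \<open>s\<close> is zero (lemma \<open>simple_sandwich_eq_zero\<close>). By biadditivity it is
  enough to let \<open>r\<close> and \<open>s\<close> be monomials. The choices of \<open>w\<close> and \<open>K\<close> are these.

  \<^item> Inverse connectedness: \<open>w = u\<^sub>f\<close>, and \<open>K\<close> consists of the elements with coefficient zero at \<open>e\<close>.
    If no factorization of \<open>e\<close> passes through \<open>f\<close>, then \<open>r u\<^sub>f s\<close> never reaches \<open>e\<close>.
  \<^item> \<open>G\<^sub>e\<close>-simplicity: \<open>w = j u\<^sub>e\<close> with \<open>j\<close> in an invariant ideal \<open>J\<close> of \<open>A e\<close>, and \<open>K\<close> consists of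
    the elements whose coefficients on \<open>G\<^sub>e\<close> lie in \<open>J\<close>.
  \<^item> Triviality of the kernel and maximal commutativity: \<open>w = r u\<^sub>m - r u\<^sub>n\<close> where
    \<open>r \<sigma>\<^sub>m(b) = r \<sigma>\<^sub>n(b)\<close> for all \<open>b\<close>, and \<open>K\<close> is the kernel of the augmentation, the sum of the
    coefficients on \<open>G\<^sub>e\<close>. With \<open>r = 1\<close> this says that \<open>\<sigma>\<close> is faithful on \<open>G\<^sub>e\<close>. If \<open>x\<close> commutes
    with \<open>A\<close>, then a nonzero coefficient \<open>x\<^sub>n\<close> forces \<open>n \<in> G\<^sub>e\<close> and \<open>x\<^sub>n \<sigma>\<^sub>n(b) = b x\<^sub>n = x\<^sub>n b\<close>, so
    \<open>r = x\<^sub>n\<close> and \<open>m = e\<close> show that \<open>n\<close> is an identity.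
  \<^item> The centre: \<open>w\<close> lies in an ideal \<open>I\<close> of the corner \<open>A\<^sub>e \<rtimes> G\<^sub>e\<close>, and \<open>K\<close> consists of the elements
    whose part on \<open>G\<^sub>e\<close> lies in \<open>I\<close>. So the corner is simple; it is unital, and the centre of a
    simple unital ring is a field, since a nonzero central element generates the whole ring.

  Over a groupoid, conversely, take a nonzero ideal \<open>I\<close>. Multiplication by a suitable \<open>u\<^sub>k\<close> moves any
  coefficient of an element to an identity, so \<open>I\<close> contains elements supported on some \<open>G\<^sub>e\<close> with
  nonzero coefficient at \<open>e\<close>; let \<open>x\<close> be one of smallest support. For \<open>a \<in> A e\<close> the element
  \<open>a x - x a\<close> lies in \<open>I\<close> and has strictly smaller support, since \<open>A e\<close> is commutative, so it is zero:
  otherwise a translate of it would contradict the choice of \<open>x\<close>. Thus \<open>x\<close> commutes with \<open>A\<close>, hence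
  lies in \<open>A\<close> by maximal commutativity, and \<open>x = a u\<^sub>e\<close> with \<open>a \<noteq> 0\<close> (lemma
  \<open>ideal_contains_diagonal\<close>). By \<open>G\<^sub>e\<close>-simplicity \<open>u\<^sub>e \<in> I\<close>, by inverse connectedness every
  \<open>u\<^sub>f\<close> is in \<open>I\<close>, and these generate the algebra.
\<close>

section \<open>The skew category algebra as a ring\<close>

context skew_category_system
begin

abbreviation algebra :: "('m \<Rightarrow> 'a) ring" where
  "algebra \<equiv> skew_category_algebra A G \<sigma>"

abbreviation mon :: "'a \<Rightarrow> 'm \<Rightarrow> 'm \<Rightarrow> 'a" where
  "mon \<equiv> monomial A G"

definition supp :: "('m \<Rightarrow> 'a) \<Rightarrow> 'm set" where
  "supp x = {n \<in> mor G. x n \<noteq> \<zero>\<^bsub>A (cod_of G n)\<^esub>}"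

lemma ring_cod: "n \<in> mor G \<Longrightarrow> ring (A (cod_of G n))"
  by (simp add: ring_A cod_ob)

lemma composableD:
  assumes "(m, n) \<in> composable G"
  shows "m \<in> mor G" "n \<in> mor G" "dom_of G m = cod_of G n"
  using assms by (auto simp: composable_def)

lemma cod_zero_closed: "n \<in> mor G \<Longrightarrow> \<zero>\<^bsub>A (cod_of G n)\<^esub> \<in> carrier (A (cod_of G n))"
  by (simp add: ring_cod ring.ring_simprules)

lemma sigma_closed:
  assumes "(m, n) \<in> composable G" "b \<in> carrier (A (cod_of G n))"
  shows "\<sigma> m b \<in> carrier (A (cod_of G m))"
  using sigma_hom[of m] assms by (auto simp: composable_def ring_hom_closed)

lemma sigma_add:
  assumes "(m, n) \<in> composable G" "b \<in> carrier (A (cod_of G n))" "b' \<in> carrier (A (cod_of G n))"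
  shows "\<sigma> m (b \<oplus>\<^bsub>A (cod_of G n)\<^esub> b') = \<sigma> m b \<oplus>\<^bsub>A (cod_of G m)\<^esub> \<sigma> m b'"
  using sigma_hom[of m] assms by (auto simp: composable_def ring_hom_add)

lemma sigma_mult:
  assumes "(m, n) \<in> composable G" "b \<in> carrier (A (cod_of G n))" "b' \<in> carrier (A (cod_of G n))"
  shows "\<sigma> m (b \<otimes>\<^bsub>A (cod_of G n)\<^esub> b') = \<sigma> m b \<otimes>\<^bsub>A (cod_of G m)\<^esub> \<sigma> m b'"
  using sigma_hom[of m] assms by (auto simp: composable_def ring_hom_mult)

lemma sigma_zero:
  assumes "(m, n) \<in> composable G"
  shows "\<sigma> m \<zero>\<^bsub>A (cod_of G n)\<^esub> = \<zero>\<^bsub>A (cod_of G m)\<^esub>"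
  using sigma_hom[of m] assms ring_hom_zero[of "\<sigma> m" "A (cod_of G n)" "A (cod_of G m)"]
  by (auto simp: composable_def ring_cod)

lemma sigma_one:
  assumes "(m, n) \<in> composable G"
  shows "\<sigma> m \<one>\<^bsub>A (cod_of G n)\<^esub> = \<one>\<^bsub>A (cod_of G m)\<^esub>"
  using sigma_hom[of m] assms by (auto simp: composable_def ring_hom_one)

lemma carrier_iff:
  "x \<in> carrier algebra \<longleftrightarrow>
     x \<in> (\<Pi>\<^sub>E n\<in>mor G. carrier (A (cod_of G n))) \<and> finite (supp x)"
  by (simp add: skew_category_algebra_def supp_def)

lemma coeff_closed: "\<lbrakk>x \<in> carrier algebra; n \<in> mor G\<rbrakk> \<Longrightarrow> x n \<in> carrier (A (cod_of G n))"
  by (auto simp: carrier_iff)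

lemma finite_supp: "x \<in> carrier algebra \<Longrightarrow> finite (supp x)"
  by (simp add: carrier_iff)

lemma algebra_eqI:
  assumes "x \<in> carrier algebra" "y \<in> carrier algebra" "\<And>n. n \<in> mor G \<Longrightarrow> x n = y n"
  shows "x = y"
  using assms by (auto simp: carrier_iff intro: PiE_ext)

lemma algebraI:
  assumes "x \<in> extensional (mor G)" "\<And>n. n \<in> mor G \<Longrightarrow> x n \<in> carrier (A (cod_of G n))"
    and "finite S" "supp x \<subseteq> S"
  shows "x \<in> carrier algebra"
  using assms by (auto simp: carrier_iff PiE_iff intro: finite_subset)

lemma zero_coeff [simp]: "n \<in> mor G \<Longrightarrow> \<zero>\<^bsub>algebra\<^esub> n = \<zero>\<^bsub>A (cod_of G n)\<^esub>"
  by (simp add: skew_category_algebra_def)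

lemma add_coeff [simp]:
  "n \<in> mor G \<Longrightarrow> (x \<oplus>\<^bsub>algebra\<^esub> y) n = x n \<oplus>\<^bsub>A (cod_of G n)\<^esub> y n"
  by (simp add: skew_category_algebra_def)

lemma supp_zero [simp]: "supp \<zero>\<^bsub>algebra\<^esub> = {}"
  by (auto simp: supp_def)

lemma zero_closed: "\<zero>\<^bsub>algebra\<^esub> \<in> carrier algebra"
proof (rule algebraI[where S = "{}"])
  show "\<zero>\<^bsub>algebra\<^esub> \<in> extensional (mor G)"
    by (simp add: skew_category_algebra_def)
qed (auto simp: supp_def cod_zero_closed)

lemma add_closed:
  assumes "x \<in> carrier algebra" "y \<in> carrier algebra"
  shows "x \<oplus>\<^bsub>algebra\<^esub> y \<in> carrier algebra"
proof (rule algebraI[where S = "supp x \<union> supp y"])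
  show "x \<oplus>\<^bsub>algebra\<^esub> y \<in> extensional (mor G)"
    by (simp add: skew_category_algebra_def)
  show "supp (x \<oplus>\<^bsub>algebra\<^esub> y) \<subseteq> supp x \<union> supp y"
  proof
    fix n assume n: "n \<in> supp (x \<oplus>\<^bsub>algebra\<^esub> y)"
    then have m: "n \<in> mor G" by (simp add: supp_def)
    interpret C: ring "A (cod_of G n)" by (rule ring_cod[OF m])
    show "n \<in> supp x \<union> supp y"
      using n m by (auto simp: supp_def)
  qed
qed (use assms in \<open>auto simp: finite_supp coeff_closed ring_cod ring.ring_simprules\<close>)

lemma abelian_group_algebra: "abelian_group algebra"
proof (rule abelian_groupI)
  fix x y z
  assume x: "x \<in> carrier algebra" and y: "y \<in> carrier algebra"
  show "x \<oplus>\<^bsub>algebra\<^esub> y = y \<oplus>\<^bsub>algebra\<^esub> x"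
    using x y by (auto intro!: algebra_eqI add_closed simp: coeff_closed ring_cod ring.ring_simprules)
  assume z: "z \<in> carrier algebra"
  show "x \<oplus>\<^bsub>algebra\<^esub> y \<oplus>\<^bsub>algebra\<^esub> z = x \<oplus>\<^bsub>algebra\<^esub> (y \<oplus>\<^bsub>algebra\<^esub> z)"
    using x y z by (intro algebra_eqI add_closed) (simp_all add: coeff_closed ring_cod ring.ring_simprules)
next
  fix x assume x: "x \<in> carrier algebra"
  show "\<zero>\<^bsub>algebra\<^esub> \<oplus>\<^bsub>algebra\<^esub> x = x"
    using x by (auto intro!: algebra_eqI add_closed zero_closed simp: coeff_closed ring_cod ring.ring_simprules)
  define y where "y = (\<lambda>n\<in>mor G. \<ominus>\<^bsub>A (cod_of G n)\<^esub> x n)"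
  have y: "y \<in> carrier algebra"
  proof (rule algebraI[where S = "supp x"])
    show "supp y \<subseteq> supp x"
    proof
      fix n assume n: "n \<in> supp y"
      then have m: "n \<in> mor G" by (simp add: supp_def)
      interpret C: ring "A (cod_of G n)" by (rule ring_cod[OF m])
      show "n \<in> supp x"
        using n m by (auto simp: supp_def y_def)
    qed
  qed (use x in \<open>auto simp: y_def finite_supp coeff_closed ring_cod ring.ring_simprules\<close>)
  moreover have "y \<oplus>\<^bsub>algebra\<^esub> x = \<zero>\<^bsub>algebra\<^esub>"
    using x y by (intro algebra_eqI add_closed zero_closed)
      (simp_all add: y_def coeff_closed ring_cod ring.ring_simprules)
  ultimately show "\<exists>y\<in>carrier algebra. y \<oplus>\<^bsub>algebra\<^esub> x = \<zero>\<^bsub>algebra\<^esub>" by blast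
qed (auto simp: add_closed zero_closed)

sublocale alg: abelian_group algebra
  by (rule abelian_group_algebra)

lemma minus_coeff [simp]:
  assumes x: "x \<in> carrier algebra" and n: "n \<in> mor G"
  shows "(\<ominus>\<^bsub>algebra\<^esub> x) n = \<ominus>\<^bsub>A (cod_of G n)\<^esub> x n"
proof -
  interpret C: ring "A (cod_of G n)" by (rule ring_cod[OF n])
  have "((\<ominus>\<^bsub>algebra\<^esub> x) \<oplus>\<^bsub>algebra\<^esub> x) n = \<zero>\<^bsub>A (cod_of G n)\<^esub>"
    using x n by (simp add: alg.l_neg)
  then show ?thesis
    using n x by (simp add: C.minus_equality coeff_closed)
qed

lemma monomial_coeff:
  "n \<in> mor G \<Longrightarrow> mon a m n = (if n = m then a else \<zero>\<^bsub>A (cod_of G n)\<^esub>)"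
  by (simp add: monomial_def)

lemma supp_monomial: "supp (mon a m) \<subseteq> {m}"
  by (auto simp: supp_def monomial_coeff split: if_splits)

lemma monomial_closed:
  assumes "m \<in> mor G" "a \<in> carrier (A (cod_of G m))"
  shows "mon a m \<in> carrier algebra"
proof (rule algebraI[where S = "{m}"])
  show "mon a m \<in> extensional (mor G)"
    by (simp add: monomial_def)
qed (use assms in \<open>auto simp: monomial_coeff supp_def cod_zero_closed split: if_splits\<close>)

text \<open>
  The monomials generate the additive group, so identities that are additive in an argument need
  only be checked there on monomials.
\<close>
lemma algebra_induct [consumes 1, case_names zero add]:
  assumes "x \<in> carrier algebra"
    and "P \<zero>\<^bsub>algebra\<^esub>"
    and "\<And>n a x. \<lbrakk>n \<in> mor G; a \<in> carrier (A (cod_of G n)); x \<in> carrier algebra; P x\<rbrakk>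
      \<Longrightarrow> P (mon a n \<oplus>\<^bsub>algebra\<^esub> x)"
  shows "P x"
  using assms(1)
proof (induction "card (supp x)" arbitrary: x)
  case 0
  then have "x n = \<zero>\<^bsub>A (cod_of G n)\<^esub>" if "n \<in> mor G" for n
    using that finite_supp[of x] by (auto simp: supp_def)
  then have "x = \<zero>\<^bsub>algebra\<^esub>"
    using 0 by (intro algebra_eqI) (auto simp: zero_closed)
  then show ?case
    using assms(2) by simp
next
  case (Suc k)
  then have fin: "finite (supp x)"
    by (simp add: finite_supp)
  from Suc(2) obtain n where n: "n \<in> supp x"
    by fastforce
  then have nm: "n \<in> mor G" by (simp add: supp_def)
  define y where "y = x(n := \<zero>\<^bsub>A (cod_of G n)\<^esub>)"
  have sy: "supp y = supp x - {n}"
    by (auto simp: supp_def y_def)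
  have y: "y \<in> carrier algebra"
    using Suc(3) nm sy fin
    by (intro algebraI[where S = "supp x"])
      (auto simp: y_def carrier_iff PiE_iff extensional_def cod_zero_closed)
  have "x = mon (x n) n \<oplus>\<^bsub>algebra\<^esub> y"
    using Suc(3) y nm
    by (intro algebra_eqI add_closed monomial_closed)
      (auto simp: coeff_closed monomial_coeff y_def ring_cod ring.ring_simprules)
  moreover have "k = card (supp y)"
    using Suc(2) sy fin n by simp
  ultimately show ?case
    using assms(3)[OF nm _ y] Suc(1)[OF _ y] Suc(3) nm by (metis coeff_closed)
qed

text \<open>
  The sum defining a coefficient of a product ranges over a set that depends on the exact supports
  of the factors. Enlarging it to arbitrary finite sets containing the supports allows products of
  \<open>x\<close>, \<open>y\<close> and \<open>x + y\<close> to be compared term by term.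
\<close>
lemma mult_coeff_finsum:
  assumes x: "x \<in> carrier algebra" and y: "y \<in> carrier algebra" and p: "p \<in> mor G"
    and S: "finite S" "supp x \<subseteq> S" and T: "finite T" "supp y \<subseteq> T"
  shows "(x \<otimes>\<^bsub>algebra\<^esub> y) p =
    finsum (A (cod_of G p)) (\<lambda>(m, n). x m \<otimes>\<^bsub>A (cod_of G p)\<^esub> \<sigma> m (y n))
      {(m, n) \<in> composable G. ccomp G m n = p \<and> m \<in> S \<and> n \<in> T}"
    (is "_ = finsum _ ?f ?B")
proof -
  interpret C: ring "A (cod_of G p)" by (rule ring_cod[OF p])
  let ?A = "{(m, n) \<in> composable G. ccomp G m n = p \<and>
          x m \<noteq> \<zero>\<^bsub>A (cod_of G m)\<^esub> \<and> y n \<noteq> \<zero>\<^bsub>A (cod_of G n)\<^esub>}"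
  have "(x \<otimes>\<^bsub>algebra\<^esub> y) p = finsum (A (cod_of G p)) ?f ?A"
    using p by (simp add: skew_category_algebra_def skew_mult_def)
  also have "\<dots> = finsum (A (cod_of G p)) ?f ?B"
  proof (rule C.add.finprod_mono_neutral_cong_left)
    show "finite ?B"
      by (rule finite_subset[of _ "S \<times> T"]) (use S T in auto)
    show "?A \<subseteq> ?B"
      using S T by (auto simp: supp_def dest: composableD)
    have cp: "cod_of G p = cod_of G m" if "(m, n) \<in> composable G" "ccomp G m n = p" for m n
      using that cod_comp by auto
    have cx: "x m \<in> carrier (A (cod_of G p))" "\<sigma> m (y n) \<in> carrier (A (cod_of G p))"
      if "(m, n) \<in> composable G" "ccomp G m n = p" for m n
      using that x y cp[OF that] sigma_closed[OF that(1)] composableD[OF that(1)]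
      by (auto simp: coeff_closed)
    have "x m \<otimes>\<^bsub>A (cod_of G p)\<^esub> \<sigma> m (y n) \<in> carrier (A (cod_of G p))"
      if "(m, n) \<in> composable G" "ccomp G m n = p" for m n
      using cx[OF that] by simp
    then show "?f \<in> ?B \<rightarrow> carrier (A (cod_of G p))"
      by auto
    show "?f i = \<zero>\<^bsub>A (cod_of G p)\<^esub>" if i: "i \<in> ?B - ?A" for i
    proof -
      obtain m n where mn: "i = (m, n)" "(m, n) \<in> composable G" "ccomp G m n = p"
        using i by auto
      consider "x m = \<zero>\<^bsub>A (cod_of G m)\<^esub>" | "y n = \<zero>\<^bsub>A (cod_of G n)\<^esub>"
        using i mn by auto
      then show ?thesis
        using cx[OF mn(2,3)] mn sigma_zero[OF mn(2)]
        by cases (simp_all add: cp[OF mn(2,3), symmetric])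
    qed
  qed auto
  finally show ?thesis .
qed

lemma mult_coeff_none:
  assumes p: "p \<in> mor G"
    and "\<And>m n. \<lbrakk>(m, n) \<in> composable G; ccomp G m n = p; m \<in> supp x; n \<in> supp y\<rbrakk> \<Longrightarrow> False"
  shows "(x \<otimes>\<^bsub>algebra\<^esub> y) p = \<zero>\<^bsub>A (cod_of G p)\<^esub>"
proof -
  interpret C: ring "A (cod_of G p)" by (rule ring_cod[OF p])
  have empty: "{(m, n) \<in> composable G. ccomp G m n = p \<and>
      x m \<noteq> \<zero>\<^bsub>A (cod_of G m)\<^esub> \<and> y n \<noteq> \<zero>\<^bsub>A (cod_of G n)\<^esub>} = {}"
    using assms(2) by (auto simp: supp_def dest: composableD)
  show ?thesis
    using p by (simp add: skew_category_algebra_def skew_mult_def empty del: Collect_empty_eq)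
qed

text \<open>
  When one factor is supported on identities, or is a monomial at an invertible morphism, at most one
  factorization contributes, and no sum is left.
\<close>
lemma mult_coeff_unique:
  assumes x: "x \<in> carrier algebra" and y: "y \<in> carrier algebra"
    and mn: "(m, n) \<in> composable G" "ccomp G m n = p"
    and uniq: "\<And>m' n'. \<lbrakk>(m', n') \<in> composable G; ccomp G m' n' = p; m' \<in> supp x; n' \<in> supp y\<rbrakk>
       \<Longrightarrow> m' = m \<and> n' = n"
  shows "(x \<otimes>\<^bsub>algebra\<^esub> y) p = x m \<otimes>\<^bsub>A (cod_of G m)\<^esub> \<sigma> m (y n)"
proof -
  have p: "p \<in> mor G" and cp: "cod_of G p = cod_of G m"
    using mn comp_mor cod_comp by auto
  interpret C: ring "A (cod_of G m)" using ring_cod composableD[OF mn(1)] by blast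
  have xm: "x m \<in> carrier (A (cod_of G m))" and yn: "\<sigma> m (y n) \<in> carrier (A (cod_of G m))"
    using mn sigma_closed composableD[OF mn(1)] x y by (auto simp: coeff_closed)
  show ?thesis
  proof (cases "m \<in> supp x \<and> n \<in> supp y")
    case True
    then have "{(m, n) \<in> composable G. ccomp G m n = p \<and> m \<in> supp x \<and> n \<in> supp y} = insert (m, n) {}"
      using mn by (auto dest: uniq)
    then show ?thesis
      using xm yn mult_coeff_finsum[OF x y p finite_supp[OF x] order_refl finite_supp[OF y] order_refl]
      by (simp add: cp C.finsum_insert del: insert_iff)
  next
    case False
    have "(x \<otimes>\<^bsub>algebra\<^esub> y) p = \<zero>\<^bsub>A (cod_of G p)\<^esub>"
      by (rule mult_coeff_none[OF p]) (use uniq False in blast)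
    moreover have "x m = \<zero>\<^bsub>A (cod_of G m)\<^esub> \<or> y n = \<zero>\<^bsub>A (cod_of G n)\<^esub>"
      using False composableD[OF mn(1)] by (auto simp: supp_def)
    ultimately show ?thesis
      using xm yn sigma_zero[OF mn(1)] by (auto simp: cp)
  qed
qed

lemma supp_mult:
  "supp (x \<otimes>\<^bsub>algebra\<^esub> y) \<subseteq>
     {ccomp G m n | m n. (m, n) \<in> composable G \<and> m \<in> supp x \<and> n \<in> supp y}"
proof
  fix p assume p: "p \<in> supp (x \<otimes>\<^bsub>algebra\<^esub> y)"
  then have pm: "p \<in> mor G" by (simp add: supp_def)
  show "p \<in> {ccomp G m n | m n. (m, n) \<in> composable G \<and> m \<in> supp x \<and> n \<in> supp y}"
    using mult_coeff_none[OF pm, of x y] p by (auto simp: supp_def)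
qed

lemma mult_closed:
  assumes x: "x \<in> carrier algebra" and y: "y \<in> carrier algebra"
  shows "x \<otimes>\<^bsub>algebra\<^esub> y \<in> carrier algebra"
proof (rule algebraI)
  show "x \<otimes>\<^bsub>algebra\<^esub> y \<in> extensional (mor G)"
    by (simp add: skew_category_algebra_def skew_mult_def)
  show "finite ((\<lambda>(m, n). ccomp G m n) ` (supp x \<times> supp y))"
    using x y by (simp add: finite_supp)
  show "supp (x \<otimes>\<^bsub>algebra\<^esub> y) \<subseteq> (\<lambda>(m, n). ccomp G m n) ` (supp x \<times> supp y)"
    using supp_mult by fast
  fix p assume p: "p \<in> mor G"
  interpret C: ring "A (cod_of G p)" by (rule ring_cod[OF p])
  have "x m \<otimes>\<^bsub>A (cod_of G p)\<^esub> \<sigma> m (y n) \<in> carrier (A (cod_of G p))"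
    if "(m, n) \<in> composable G" "ccomp G m n = p" for m n
  proof (rule C.m_closed)
    show "x m \<in> carrier (A (cod_of G p))" "\<sigma> m (y n) \<in> carrier (A (cod_of G p))"
      using that x y cod_comp[OF that(1)] sigma_closed[OF that(1)] composableD[OF that(1)]
      by (auto simp: coeff_closed)
  qed
  then show "(x \<otimes>\<^bsub>algebra\<^esub> y) p \<in> carrier (A (cod_of G p))"
    unfolding mult_coeff_finsum[OF x y p finite_supp[OF x] order_refl finite_supp[OF y] order_refl]
    by (intro C.finsum_closed) auto
qed

lemma distrib_right:
  assumes x: "x \<in> carrier algebra" and y: "y \<in> carrier algebra" and z: "z \<in> carrier algebra"
  shows "(x \<oplus>\<^bsub>algebra\<^esub> y) \<otimes>\<^bsub>algebra\<^esub> z = x \<otimes>\<^bsub>algebra\<^esub> z \<oplus>\<^bsub>algebra\<^esub> y \<otimes>\<^bsub>algebra\<^esub> z"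
proof (rule algebra_eqI)
  fix p assume p: "p \<in> mor G"
  interpret C: ring "A (cod_of G p)" by (rule ring_cod[OF p])
  let ?S = "supp x \<union> supp y \<union> supp (x \<oplus>\<^bsub>algebra\<^esub> y)"
  have fin: "finite ?S" "finite (supp z)"
    using x y z by (auto simp: finite_supp)
  let ?B = "{(m, n) \<in> composable G. ccomp G m n = p \<and> m \<in> ?S \<and> n \<in> supp z}"
  have cx: "x m \<in> carrier (A (cod_of G p))" "y m \<in> carrier (A (cod_of G p))"
      "\<sigma> m (z n) \<in> carrier (A (cod_of G p))"
      "m \<in> mor G" "cod_of G m = cod_of G p"
    if "(m, n) \<in> composable G" "ccomp G m n = p" for m n
    using that x y z cod_comp[OF that(1)] sigma_closed[OF that(1)] composableD[OF that(1)]
    by (auto simp: coeff_closed)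
  have terms: "x m \<otimes>\<^bsub>A (cod_of G p)\<^esub> \<sigma> m (z n) \<in> carrier (A (cod_of G p))"
      "y m \<otimes>\<^bsub>A (cod_of G p)\<^esub> \<sigma> m (z n) \<in> carrier (A (cod_of G p))"
      "(x \<oplus>\<^bsub>algebra\<^esub> y) m \<otimes>\<^bsub>A (cod_of G p)\<^esub> \<sigma> m (z n)
        = x m \<otimes>\<^bsub>A (cod_of G p)\<^esub> \<sigma> m (z n) \<oplus>\<^bsub>A (cod_of G p)\<^esub> y m \<otimes>\<^bsub>A (cod_of G p)\<^esub> \<sigma> m (z n)"
    if "(m, n) \<in> composable G" "ccomp G m n = p" for m n
    using cx[OF that] by (simp_all add: C.l_distr)
  have sums: "x m \<otimes>\<^bsub>A (cod_of G p)\<^esub> \<sigma> m (z n) \<oplus>\<^bsub>A (cod_of G p)\<^esub> y m \<otimes>\<^bsub>A (cod_of G p)\<^esub> \<sigma> m (z n) \<in> carrier (A (cod_of G p))"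
    if "(m, n) \<in> composable G" "ccomp G m n = p" for m n
    using terms(1,2)[OF that] by simp
  let ?f = "\<lambda>x (m, n). x m \<otimes>\<^bsub>A (cod_of G p)\<^esub> \<sigma> m (z n)"
  have eq: "(u \<otimes>\<^bsub>algebra\<^esub> z) p = finsum (A (cod_of G p)) (?f u) ?B"
    if "u \<in> carrier algebra" "supp u \<subseteq> ?S" for u
    by (rule mult_coeff_finsum[OF that(1) z p fin(1) that(2) fin(2) order_refl])
  have "((x \<oplus>\<^bsub>algebra\<^esub> y) \<otimes>\<^bsub>algebra\<^esub> z) p
      = finsum (A (cod_of G p)) (\<lambda>i. ?f x i \<oplus>\<^bsub>A (cod_of G p)\<^esub> ?f y i) ?B"
    unfolding eq[OF add_closed[OF x y] Un_upper2]
    by (rule C.finsum_cong') (use terms(3) sums in \<open>auto simp del: C.add.m_closed\<close>)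
  also have "\<dots> = finsum (A (cod_of G p)) (?f x) ?B \<oplus>\<^bsub>A (cod_of G p)\<^esub> finsum (A (cod_of G p)) (?f y) ?B"
    by (rule C.finsum_addf) (use terms(1,2) in auto)
  also have "\<dots> = (x \<otimes>\<^bsub>algebra\<^esub> z \<oplus>\<^bsub>algebra\<^esub> y \<otimes>\<^bsub>algebra\<^esub> z) p"
    using p x y by (subst (1 2) eq[symmetric]) auto
  finally show "((x \<oplus>\<^bsub>algebra\<^esub> y) \<otimes>\<^bsub>algebra\<^esub> z) p = (x \<otimes>\<^bsub>algebra\<^esub> z \<oplus>\<^bsub>algebra\<^esub> y \<otimes>\<^bsub>algebra\<^esub> z) p" .
qed (use x y z in \<open>auto simp: add_closed mult_closed\<close>)

lemma distrib_left:
  assumes x: "x \<in> carrier algebra" and y: "y \<in> carrier algebra" and z: "z \<in> carrier algebra"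
  shows "z \<otimes>\<^bsub>algebra\<^esub> (x \<oplus>\<^bsub>algebra\<^esub> y) = z \<otimes>\<^bsub>algebra\<^esub> x \<oplus>\<^bsub>algebra\<^esub> z \<otimes>\<^bsub>algebra\<^esub> y"
proof (rule algebra_eqI)
  fix p assume p: "p \<in> mor G"
  interpret C: ring "A (cod_of G p)" by (rule ring_cod[OF p])
  let ?S = "supp x \<union> supp y \<union> supp (x \<oplus>\<^bsub>algebra\<^esub> y)"
  have fin: "finite ?S" "finite (supp z)"
    using x y z by (auto simp: finite_supp)
  let ?B = "{(m, n) \<in> composable G. ccomp G m n = p \<and> m \<in> supp z \<and> n \<in> ?S}"
  have cx: "\<sigma> m (x n) \<in> carrier (A (cod_of G p))" "\<sigma> m (y n) \<in> carrier (A (cod_of G p))"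
      "z m \<in> carrier (A (cod_of G p))"
      "n \<in> mor G" "\<sigma> m (x n \<oplus>\<^bsub>A (cod_of G n)\<^esub> y n) = \<sigma> m (x n) \<oplus>\<^bsub>A (cod_of G p)\<^esub> \<sigma> m (y n)"
    if "(m, n) \<in> composable G" "ccomp G m n = p" for m n
    using that x y z cod_comp[OF that(1)] sigma_closed[OF that(1)] composableD[OF that(1)]
    by (auto simp: coeff_closed sigma_add)
  have terms: "z m \<otimes>\<^bsub>A (cod_of G p)\<^esub> \<sigma> m (x n) \<in> carrier (A (cod_of G p))"
      "z m \<otimes>\<^bsub>A (cod_of G p)\<^esub> \<sigma> m (y n) \<in> carrier (A (cod_of G p))"
      "z m \<otimes>\<^bsub>A (cod_of G p)\<^esub> \<sigma> m ((x \<oplus>\<^bsub>algebra\<^esub> y) n)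
        = z m \<otimes>\<^bsub>A (cod_of G p)\<^esub> \<sigma> m (x n) \<oplus>\<^bsub>A (cod_of G p)\<^esub> z m \<otimes>\<^bsub>A (cod_of G p)\<^esub> \<sigma> m (y n)"
    if "(m, n) \<in> composable G" "ccomp G m n = p" for m n
    using cx[OF that] by (simp_all add: C.r_distr)
  have sums: "z m \<otimes>\<^bsub>A (cod_of G p)\<^esub> \<sigma> m (x n) \<oplus>\<^bsub>A (cod_of G p)\<^esub> z m \<otimes>\<^bsub>A (cod_of G p)\<^esub> \<sigma> m (y n) \<in> carrier (A (cod_of G p))"
    if "(m, n) \<in> composable G" "ccomp G m n = p" for m n
    using terms(1,2)[OF that] by simp
  let ?f = "\<lambda>x (m, n). z m \<otimes>\<^bsub>A (cod_of G p)\<^esub> \<sigma> m (x n)"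
  have eq: "(z \<otimes>\<^bsub>algebra\<^esub> u) p = finsum (A (cod_of G p)) (?f u) ?B"
    if "u \<in> carrier algebra" "supp u \<subseteq> ?S" for u
    by (rule mult_coeff_finsum[OF z that(1) p fin(2) order_refl fin(1) that(2)])
  have "(z \<otimes>\<^bsub>algebra\<^esub> (x \<oplus>\<^bsub>algebra\<^esub> y)) p
      = finsum (A (cod_of G p)) (\<lambda>i. ?f x i \<oplus>\<^bsub>A (cod_of G p)\<^esub> ?f y i) ?B"
    unfolding eq[OF add_closed[OF x y] Un_upper2]
    by (rule C.finsum_cong') (use terms(3) sums in \<open>auto simp del: C.add.m_closed\<close>)
  also have "\<dots> = finsum (A (cod_of G p)) (?f x) ?B \<oplus>\<^bsub>A (cod_of G p)\<^esub> finsum (A (cod_of G p)) (?f y) ?B"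
    by (rule C.finsum_addf) (use terms(1,2) in auto)
  also have "\<dots> = (z \<otimes>\<^bsub>algebra\<^esub> x \<oplus>\<^bsub>algebra\<^esub> z \<otimes>\<^bsub>algebra\<^esub> y) p"
    using p x y by (subst (1 2) eq[symmetric]) auto
  finally show "(z \<otimes>\<^bsub>algebra\<^esub> (x \<oplus>\<^bsub>algebra\<^esub> y)) p = (z \<otimes>\<^bsub>algebra\<^esub> x \<oplus>\<^bsub>algebra\<^esub> z \<otimes>\<^bsub>algebra\<^esub> y) p" .
qed (use x y z in \<open>auto simp: add_closed mult_closed\<close>)

lemma zero_mult:
  assumes "x \<in> carrier algebra"
  shows "\<zero>\<^bsub>algebra\<^esub> \<otimes>\<^bsub>algebra\<^esub> x = \<zero>\<^bsub>algebra\<^esub>"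
  using assms by (intro algebra_eqI mult_closed zero_closed)
    (auto intro!: mult_coeff_none simp: supp_def)

lemma mult_zero:
  assumes "x \<in> carrier algebra"
  shows "x \<otimes>\<^bsub>algebra\<^esub> \<zero>\<^bsub>algebra\<^esub> = \<zero>\<^bsub>algebra\<^esub>"
  using assms by (intro algebra_eqI mult_closed zero_closed)
    (auto intro!: mult_coeff_none simp: supp_def)

lemma monomial_assoc:
  assumes l: "l \<in> mor G" and m: "m \<in> mor G" and n: "n \<in> mor G"
    and a: "a \<in> carrier (A (cod_of G l))" and b: "b \<in> carrier (A (cod_of G m))"
    and c: "c \<in> carrier (A (cod_of G n))"
  shows "(mon a l \<otimes>\<^bsub>algebra\<^esub> mon b m) \<otimes>\<^bsub>algebra\<^esub> mon c n
    = mon a l \<otimes>\<^bsub>algebra\<^esub> (mon b m \<otimes>\<^bsub>algebra\<^esub> mon c n)"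
proof -
  consider "(l, m) \<in> composable G" "(m, n) \<in> composable G"
    | "(l, m) \<in> composable G" "(m, n) \<notin> composable G"
    | "(l, m) \<notin> composable G" "(m, n) \<in> composable G"
    | "(l, m) \<notin> composable G" "(m, n) \<notin> composable G"
    by blast
  then show ?thesis
  proof cases
    case 1
    interpret C: ring "A (cod_of G l)" by (rule ring_cod[OF l])
    interpret M: ring "A (cod_of G m)" by (rule ring_cod[OF m])
    have "(ccomp G l m, n) \<in> composable G" "(l, ccomp G m n) \<in> composable G"
      using 1 by (auto simp: composable_def comp_mor dom_comp cod_comp)
    moreover have "\<sigma> l (\<sigma> m c) = \<sigma> (ccomp G l m) c"
      using sigma_comp[OF 1(1)] c composableD[OF 1(2)] by auto
    moreover have "\<sigma> m c \<in> carrier (A (cod_of G m))"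
        "\<sigma> l b \<in> carrier (A (cod_of G l))" "\<sigma> l (\<sigma> m c) \<in> carrier (A (cod_of G l))"
      using 1 b c by (auto intro: sigma_closed)
    moreover have "\<sigma> l (b \<otimes>\<^bsub>A (cod_of G m)\<^esub> \<sigma> m c) = \<sigma> l b \<otimes>\<^bsub>A (cod_of G l)\<^esub> \<sigma> l (\<sigma> m c)"
      using calculation b 1 by (intro sigma_mult) auto
    ultimately show ?thesis
      using 1 assms
      by (simp add: monomial_mult comp_mor cod_comp C.m_assoc comp_assoc)
  next
    case 2
    then have "(ccomp G l m, n) \<notin> composable G"
      by (auto simp: composable_def comp_mor dom_comp)
    then show ?thesis
      using 2 assms
      by (simp add: monomial_mult comp_mor cod_comp ring_cod ring.ring_simprules sigma_closed mult_zero monomial_closed)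
  next
    case 3
    then have "(l, ccomp G m n) \<notin> composable G"
      by (auto simp: composable_def comp_mor cod_comp)
    then show ?thesis
      using 3 assms
      by (simp add: monomial_mult comp_mor cod_comp ring_cod ring.ring_simprules sigma_closed zero_mult monomial_closed)
  next
    case 4
    then show ?thesis
      using assms by (simp add: monomial_mult zero_mult mult_zero monomial_closed)
  qed
qed

text \<open>
  Additivity in each of the three arguments reduces associativity to monomials, where it is the
  associativity of composition together with functoriality of \<open>\<sigma>\<close>; no double sum appears.
\<close>
lemma algebra_assoc:
  assumes "x \<in> carrier algebra" "y \<in> carrier algebra" "z \<in> carrier algebra"
  shows "(x \<otimes>\<^bsub>algebra\<^esub> y) \<otimes>\<^bsub>algebra\<^esub> z = x \<otimes>\<^bsub>algebra\<^esub> (y \<otimes>\<^bsub>algebra\<^esub> z)"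
  using assms(1)
proof (induction rule: algebra_induct)
  case zero
  then show ?case using assms by (simp add: zero_mult mult_closed)
next
  case (add l a x)
  have "(mon a l \<otimes>\<^bsub>algebra\<^esub> y) \<otimes>\<^bsub>algebra\<^esub> z = mon a l \<otimes>\<^bsub>algebra\<^esub> (y \<otimes>\<^bsub>algebra\<^esub> z)"
    using assms(2)
  proof (induction rule: algebra_induct)
    case zero
    then show ?case using assms add by (simp add: zero_mult mult_zero mult_closed monomial_closed)
  next
    case (add m b y)
    have "(mon a l \<otimes>\<^bsub>algebra\<^esub> mon b m) \<otimes>\<^bsub>algebra\<^esub> z = mon a l \<otimes>\<^bsub>algebra\<^esub> (mon b m \<otimes>\<^bsub>algebra\<^esub> z)"
      using assms(3)
    proof (induction rule: algebra_induct)
      case zero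
      then show ?case
        using \<open>l \<in> mor G\<close> \<open>a \<in> _\<close> add by (simp add: zero_mult mult_zero mult_closed monomial_closed)
    next
      case (add n c z)
      then show ?case
        using \<open>l \<in> mor G\<close> \<open>a \<in> _\<close> \<open>m \<in> mor G\<close> \<open>b \<in> _\<close>
        by (simp add: distrib_left mult_closed monomial_closed monomial_assoc)
    qed
    then show ?case
      using \<open>l \<in> mor G\<close> \<open>a \<in> _\<close> add assms
      by (simp add: distrib_left distrib_right mult_closed add_closed monomial_closed)
  qed
  then show ?case
    using add assms by (simp add: distrib_right mult_closed monomial_closed)
qed

text \<open>
  An element supported on identities acts on coefficients one at a time: from the left through its
  value at the codomain, from the right through its value at the domain, twisted by \<open>\<sigma>\<close>. Both the
  unit laws and all statements about commuting with \<open>A\<close> come from these two formulas.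
\<close>
lemma diagonal_mult_coeff:
  assumes b: "b \<in> carrier algebra" "supp b \<subseteq> ob G" and x: "x \<in> carrier algebra" and n: "n \<in> mor G"
  shows "(b \<otimes>\<^bsub>algebra\<^esub> x) n = b (cod_of G n) \<otimes>\<^bsub>A (cod_of G n)\<^esub> x n"
proof -
  have c: "cod_of G n \<in> ob G" "cod_of G n \<in> mor G" "(cod_of G n, n) \<in> composable G"
    using n cod_ob ob_mor by (auto simp: composable_def ident_dom)
  have "(b \<otimes>\<^bsub>algebra\<^esub> x) n
      = b (cod_of G n) \<otimes>\<^bsub>A (cod_of G (cod_of G n))\<^esub> \<sigma> (cod_of G n) (x n)"
  proof (rule mult_coeff_unique[OF b(1) x c(3) ident_left[OF n]])
    fix m' n' assume *: "(m', n') \<in> composable G" "ccomp G m' n' = n" "m' \<in> supp b"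
    then have "m' = cod_of G n'"
      using b(2) composableD[OF *(1)] ident_dom by auto
    then show "m' = cod_of G n \<and> n' = n"
      using * ident_left composableD[OF *(1)] by auto
  qed
  then show ?thesis
    using c x n by (simp add: ident_cod sigma_ident coeff_closed)
qed

lemma mult_diagonal_coeff:
  assumes b: "b \<in> carrier algebra" "supp b \<subseteq> ob G" and x: "x \<in> carrier algebra" and n: "n \<in> mor G"
  shows "(x \<otimes>\<^bsub>algebra\<^esub> b) n = x n \<otimes>\<^bsub>A (cod_of G n)\<^esub> \<sigma> n (b (dom_of G n))"
proof (rule mult_coeff_unique[OF x b(1) _ ident_right[OF n]])
  show "(n, dom_of G n) \<in> composable G"
    using n dom_ob ob_mor by (auto simp: composable_def ident_cod)
  fix m' n' assume *: "(m', n') \<in> composable G" "ccomp G m' n' = n" "n' \<in> supp b"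
  then have "n' = dom_of G m'"
    using b(2) composableD[OF *(1)] ident_cod by auto
  then show "m' = n \<and> n' = dom_of G n"
    using * ident_right composableD[OF *(1)] by auto
qed

lemma ring_algebra:
  assumes fin: "finite (ob G)"
  shows "ring algebra"
proof -
  have one: "\<one>\<^bsub>algebra\<^esub> n = (if n \<in> ob G then \<one>\<^bsub>A n\<^esub> else \<zero>\<^bsub>A (cod_of G n)\<^esub>)" if "n \<in> mor G" for n
    using that by (simp add: skew_category_algebra_def)
  have supp_one: "supp \<one>\<^bsub>algebra\<^esub> \<subseteq> ob G"
    by (auto simp: supp_def one split: if_splits)
  have one_closed: "\<one>\<^bsub>algebra\<^esub> \<in> carrier algebra"
  proof (rule algebraI[OF _ _ fin supp_one])
    show "\<one>\<^bsub>algebra\<^esub> \<in> extensional (mor G)"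
      by (simp add: skew_category_algebra_def)
    show "\<one>\<^bsub>algebra\<^esub> n \<in> carrier (A (cod_of G n))" if "n \<in> mor G" for n
      using that by (auto simp: one ident_cod ring_A ring_cod ring.ring_simprules)
  qed
  have l: "\<one>\<^bsub>algebra\<^esub> \<otimes>\<^bsub>algebra\<^esub> x = x" if x: "x \<in> carrier algebra" for x
  proof (rule algebra_eqI[OF mult_closed[OF one_closed x] x])
    fix n assume n: "n \<in> mor G"
    interpret C: ring "A (cod_of G n)" by (rule ring_cod[OF n])
    show "(\<one>\<^bsub>algebra\<^esub> \<otimes>\<^bsub>algebra\<^esub> x) n = x n"
      using n x cod_ob[OF n] ob_mor
      by (simp add: diagonal_mult_coeff[OF one_closed supp_one] one subset_iff coeff_closed)
  qed
  have r: "x \<otimes>\<^bsub>algebra\<^esub> \<one>\<^bsub>algebra\<^esub> = x" if x: "x \<in> carrier algebra" for x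
  proof (rule algebra_eqI[OF mult_closed[OF x one_closed] x])
    fix n assume n: "n \<in> mor G"
    interpret C: ring "A (cod_of G n)" by (rule ring_cod[OF n])
    have "(n, dom_of G n) \<in> composable G"
      using n dom_ob ob_mor by (auto simp: composable_def ident_cod)
    then have "\<sigma> n \<one>\<^bsub>A (dom_of G n)\<^esub> = \<one>\<^bsub>A (cod_of G n)\<^esub>"
      using sigma_one dom_ob[OF n] by (fastforce simp: ident_cod)
    then show "(x \<otimes>\<^bsub>algebra\<^esub> \<one>\<^bsub>algebra\<^esub>) n = x n"
      using n x dom_ob[OF n] ob_mor
      by (simp add: mult_diagonal_coeff[OF one_closed supp_one] one subset_iff coeff_closed)
  qed
  show ?thesis
    by (intro ringI monoidI abelian_group_algebra)
      (auto simp: mult_closed one_closed algebra_assoc l r distrib_left distrib_right)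
qed

end

section \<open>Simple unital rings\<close>

lemma (in abelian_group) additive_subgroupI_closed:
  assumes "K \<subseteq> carrier G" "\<zero> \<in> K" "\<And>x y. \<lbrakk>x \<in> K; y \<in> K\<rbrakk> \<Longrightarrow> x \<oplus> y \<in> K"
    and "\<And>x. x \<in> K \<Longrightarrow> \<ominus> x \<in> K"
  shows "additive_subgroup K G"
  using assms by (intro additive_subgroupI subgroup.intro) (auto simp: a_inv_def)

lemma two_sided_idealD:
  assumes "two_sided_ideal I R" and "abelian_group R"
  shows "I \<subseteq> carrier R" "\<zero>\<^bsub>R\<^esub> \<in> I" "\<And>x y. \<lbrakk>x \<in> I; y \<in> I\<rbrakk> \<Longrightarrow> x \<oplus>\<^bsub>R\<^esub> y \<in> I"
    and "\<And>x. x \<in> I \<Longrightarrow> \<ominus>\<^bsub>R\<^esub> x \<in> I"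
    and "\<And>a x. \<lbrakk>a \<in> I; x \<in> carrier R\<rbrakk> \<Longrightarrow> x \<otimes>\<^bsub>R\<^esub> a \<in> I"
    and "\<And>a x. \<lbrakk>a \<in> I; x \<in> carrier R\<rbrakk> \<Longrightarrow> a \<otimes>\<^bsub>R\<^esub> x \<in> I"
proof -
  interpret additive_subgroup I R
    using assms by (simp add: two_sided_ideal_def)
  show "I \<subseteq> carrier R" "\<zero>\<^bsub>R\<^esub> \<in> I" "\<And>x y. \<lbrakk>x \<in> I; y \<in> I\<rbrakk> \<Longrightarrow> x \<oplus>\<^bsub>R\<^esub> y \<in> I"
    by (auto simp: a_subset)
  show "\<And>x. x \<in> I \<Longrightarrow> \<ominus>\<^bsub>R\<^esub> x \<in> I"
    using a_inv_closed assms(2) by blast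
qed (use assms in \<open>auto simp: two_sided_ideal_def\<close>)

lemma (in ring) one_in_ideal:
  assumes I: "two_sided_ideal I R" and one: "\<one> \<in> I"
  shows "I = carrier R"
proof
  show "carrier R \<subseteq> I"
    using two_sided_idealD(5)[OF I abelian_group_axioms one] by fastforce
qed (rule two_sided_idealD(1)[OF I abelian_group_axioms])

text \<open>
  For a nonzero central \<open>z\<close> the set of multiples of \<open>z\<close> is a two-sided ideal, so it contains \<open>1\<close> and
  \<open>z\<close> is invertible; the inverse of a central element is central.
\<close>
lemma (in ring) center_of_simple_is_field:
  assumes simple: "simple_ring R" and nz: "\<one> \<noteq> \<zero>"
  shows "field (center_ring R)"
proof -
  let ?Z = "commutant (carrier R) R"
  have Z: "z \<in> ?Z \<longleftrightarrow> z \<in> carrier R \<and> (\<forall>x\<in>carrier R. z \<otimes> x = x \<otimes> z)" for z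
    by (auto simp: commutant_def)
  have "subcring ?Z R"
  proof (intro subcringI subringI)
    fix h assume h: "h \<in> ?Z"
    then have "\<ominus> h \<otimes> x = x \<otimes> \<ominus> h" if "x \<in> carrier R" for x
      using that h unfolding Z by (metis l_minus r_minus)
    then show "\<ominus> h \<in> ?Z"
      using h unfolding Z by simp
  next
    fix g h assume gh: "g \<in> ?Z" "h \<in> ?Z"
    then show "g \<otimes> h = h \<otimes> g"
      unfolding Z by blast
    have "(g \<oplus> h) \<otimes> x = x \<otimes> (g \<oplus> h)" "g \<otimes> h \<otimes> x = x \<otimes> (g \<otimes> h)"
      if x: "x \<in> carrier R" for x
    proof -
      have c: "g \<in> carrier R" "h \<in> carrier R" "g \<otimes> x = x \<otimes> g" "h \<otimes> x = x \<otimes> h"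
        using gh x unfolding Z by blast+
      show "(g \<oplus> h) \<otimes> x = x \<otimes> (g \<oplus> h)"
        using c x by (simp add: l_distr r_distr)
      have "g \<otimes> h \<otimes> x = g \<otimes> x \<otimes> h"
        using c(1,2,4) x by (simp add: m_assoc)
      also have "\<dots> = x \<otimes> (g \<otimes> h)"
        using c(1-3) x by (simp add: m_assoc)
      finally show "g \<otimes> h \<otimes> x = x \<otimes> (g \<otimes> h)" .
    qed
    then show "g \<oplus> h \<in> ?Z" "g \<otimes> h \<in> ?Z"
      using gh unfolding Z by blast+
  qed (auto simp: Z)
  moreover have "?Z \<subseteq> carrier R"
    by (auto simp: commutant_def)
  ultimately interpret Z: cring "R\<lparr>carrier := ?Z\<rparr>"
    by (simp add: subcring_iff)
  have inverse: "\<exists>y\<in>?Z. z \<otimes> y = \<one>" if z: "z \<in> ?Z" "z \<noteq> \<zero>" for z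
  proof -
    have zc: "z \<in> carrier R" and comm: "\<And>x. x \<in> carrier R \<Longrightarrow> z \<otimes> x = x \<otimes> z"
      using z unfolding Z by blast+
    define I where "I = {z \<otimes> x | x. x \<in> carrier R}"
    have "two_sided_ideal I R"
      unfolding two_sided_ideal_def
    proof (intro conjI ballI additive_subgroupI_closed)
      show "I \<subseteq> carrier R"
        using zc by (auto simp: I_def)
      show "\<zero> \<in> I"
        using zc by (auto simp: I_def intro!: exI[of _ \<zero>])
      show "x \<oplus> y \<in> I" if "x \<in> I" "y \<in> I" for x y
        using that zc unfolding I_def by (smt (verit) a_closed mem_Collect_eq r_distr)
      show "\<ominus> x \<in> I" if "x \<in> I" for x
        using that zc unfolding I_def by (smt (verit) a_inv_closed mem_Collect_eq r_minus)
      fix a x assume a: "a \<in> I" and x: "x \<in> carrier R"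
      then obtain b where b: "b \<in> carrier R" "a = z \<otimes> b"
        by (auto simp: I_def)
      have "a \<otimes> x = z \<otimes> (b \<otimes> x)" "x \<otimes> a = z \<otimes> (x \<otimes> b)"
        using b x zc comm[OF x] by (simp_all add: m_assoc[symmetric])
      then show "a \<otimes> x \<in> I" "x \<otimes> a \<in> I"
        using b x by (auto simp: I_def)
    qed
    moreover have "z \<in> I"
      using zc unfolding I_def by (metis (mono_tags, lifting) mem_Collect_eq one_closed r_one)
    ultimately have "I = carrier R"
      using simple z(2) unfolding simple_ring_def nontrivial_ideal_def by blast
    then obtain y where y: "y \<in> carrier R" "z \<otimes> y = \<one>"
      unfolding I_def by (smt (verit) mem_Collect_eq one_closed)
    \<comment> \<open>The product \<open>y z x y\<close> is evaluated in two ways.\<close>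
    have "y \<otimes> x = x \<otimes> y" if x: "x \<in> carrier R" for x
    proof -
      have "y \<otimes> x = y \<otimes> x \<otimes> (z \<otimes> y)"
        using x y zc by simp
      also have "\<dots> = y \<otimes> (z \<otimes> x) \<otimes> y"
        using x y zc comm[OF x] by (simp add: m_assoc)
      also have "\<dots> = (z \<otimes> y) \<otimes> x \<otimes> y"
        using x y zc comm[OF y(1)] by (simp add: m_assoc[symmetric])
      also have "\<dots> = x \<otimes> y"
        using x y by simp
      finally show ?thesis .
    qed
    then show ?thesis
      using y unfolding Bex_def Z by blast
  qed
  show ?thesis
    unfolding center_ring_def
    using Z.cring_fieldI2 nz inverse by simp
qed

section \<open>Consequences of simplicity\<close>

context skew_category_system
begin

abbreviation unit_at :: "'m \<Rightarrow> 'm \<Rightarrow> 'a" where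
  "unit_at e \<equiv> mon \<one>\<^bsub>A e\<^esub> e"

lemma ob_in_mor: "e \<in> ob G \<Longrightarrow> e \<in> mor G"
  using ob_mor by blast

lemma one_closed_A: "e \<in> ob G \<Longrightarrow> \<one>\<^bsub>A e\<^esub> \<in> carrier (A e)"
  by (simp add: ring_A ring.ring_simprules)

lemma ident_composable: "e \<in> ob G \<Longrightarrow> (e, e) \<in> composable G"
  by (simp add: composable_def ident_dom ident_cod ob_in_mor)

lemma unit_at_closed: "e \<in> ob G \<Longrightarrow> unit_at e \<in> carrier algebra"
  by (simp add: monomial_closed ob_in_mor ident_cod one_closed_A)

lemma ident_comp: "e \<in> ob G \<Longrightarrow> ccomp G e e = e"
  using ident_left[of e] by (simp add: ident_cod ob_in_mor)

lemma unit_at_idem: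
  assumes e: "e \<in> ob G"
  shows "unit_at e \<otimes>\<^bsub>algebra\<^esub> unit_at e = unit_at e"
proof -
  interpret E: ring "A e" by (rule ring_A[OF e])
  show ?thesis
    using e by (simp add: monomial_mult ob_in_mor ident_cod ident_composable ident_comp sigma_ident)
qed

text \<open>
  The elements that every two-sided multiplication sends into \<open>K\<close> form the largest ideal all of whose
  two-sided multiples lie in \<open>K\<close>. It cannot contain \<open>u\<^sub>e = u\<^sub>e u\<^sub>e u\<^sub>e\<close>, which is not in \<open>K\<close>, so simplicity
  makes it zero.
\<close>
lemma simple_sandwich_eq_zero:
  assumes simple: "simple_ring algebra" and K: "additive_subgroup K algebra"
    and e: "e \<in> ob G" and unit: "unit_at e \<notin> K" and w: "w \<in> carrier algebra"
    and sandwich: "\<And>r s. \<lbrakk>r \<in> carrier algebra; s \<in> carrier algebra\<rbrakk>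
      \<Longrightarrow> (r \<otimes>\<^bsub>algebra\<^esub> w) \<otimes>\<^bsub>algebra\<^esub> s \<in> K"
  shows "w = \<zero>\<^bsub>algebra\<^esub>"
proof -
  interpret K: additive_subgroup K algebra by (rule K)
  define I where "I = {x \<in> carrier algebra. \<forall>r\<in>carrier algebra. \<forall>s\<in>carrier algebra.
    (r \<otimes>\<^bsub>algebra\<^esub> x) \<otimes>\<^bsub>algebra\<^esub> s \<in> K}"
  have minus: "(r \<otimes>\<^bsub>algebra\<^esub> (\<ominus>\<^bsub>algebra\<^esub> x)) \<otimes>\<^bsub>algebra\<^esub> s = \<ominus>\<^bsub>algebra\<^esub> ((r \<otimes>\<^bsub>algebra\<^esub> x) \<otimes>\<^bsub>algebra\<^esub> s)"
    if "r \<in> carrier algebra" "x \<in> carrier algebra" "s \<in> carrier algebra" for r x s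
  proof -
    have "(r \<otimes>\<^bsub>algebra\<^esub> (\<ominus>\<^bsub>algebra\<^esub> x)) \<otimes>\<^bsub>algebra\<^esub> s \<oplus>\<^bsub>algebra\<^esub> (r \<otimes>\<^bsub>algebra\<^esub> x) \<otimes>\<^bsub>algebra\<^esub> s
        = (r \<otimes>\<^bsub>algebra\<^esub> (\<ominus>\<^bsub>algebra\<^esub> x \<oplus>\<^bsub>algebra\<^esub> x)) \<otimes>\<^bsub>algebra\<^esub> s"
      using that by (simp add: distrib_left distrib_right mult_closed)
    also have "\<dots> = \<zero>\<^bsub>algebra\<^esub>"
      using that by (simp add: alg.l_neg mult_zero zero_mult)
    finally show ?thesis
      using that by (simp add: alg.minus_equality mult_closed)
  qed
  have "two_sided_ideal I algebra"
    unfolding two_sided_ideal_def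
  proof (intro conjI ballI alg.additive_subgroupI_closed)
    show "\<zero>\<^bsub>algebra\<^esub> \<in> I"
      by (auto simp: I_def mult_zero zero_mult zero_closed)
    show "x \<oplus>\<^bsub>algebra\<^esub> y \<in> I" if "x \<in> I" "y \<in> I" for x y
      using that by (auto simp: I_def distrib_left distrib_right mult_closed)
    show "\<ominus>\<^bsub>algebra\<^esub> x \<in> I" if "x \<in> I" for x
      using that by (auto simp: I_def minus)
    fix a x assume a: "a \<in> I" and x: "x \<in> carrier algebra"
    then show "x \<otimes>\<^bsub>algebra\<^esub> a \<in> I"
      by (auto simp: I_def mult_closed algebra_assoc[of _ x a, symmetric])
    show "a \<otimes>\<^bsub>algebra\<^esub> x \<in> I"
      using a x by (auto simp: I_def mult_closed algebra_assoc)
  qed (auto simp: I_def)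
  moreover have "unit_at e \<notin> I"
    using unit unit_at_idem[OF e] unit_at_closed[OF e] by (force simp: I_def)
  ultimately have "I = {\<zero>\<^bsub>algebra\<^esub>}"
    using simple unit_at_closed[OF e] unfolding simple_ring_def nontrivial_ideal_def by blast
  moreover have "w \<in> I"
    using w sandwich by (simp add: I_def)
  ultimately show ?thesis by simp
qed

lemma sandwich_by_monomials:
  assumes K: "additive_subgroup K algebra" and w: "w \<in> carrier algebra"
    and monomials: "\<And>p q a b. \<lbrakk>p \<in> mor G; q \<in> mor G; a \<in> carrier (A (cod_of G p)); b \<in> carrier (A (cod_of G q))\<rbrakk>
      \<Longrightarrow> (mon a p \<otimes>\<^bsub>algebra\<^esub> w) \<otimes>\<^bsub>algebra\<^esub> mon b q \<in> K"
    and r: "r \<in> carrier algebra" and s: "s \<in> carrier algebra"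
  shows "(r \<otimes>\<^bsub>algebra\<^esub> w) \<otimes>\<^bsub>algebra\<^esub> s \<in> K"
proof -
  interpret K: additive_subgroup K algebra by (rule K)
  show ?thesis
    using r
  proof (induction rule: algebra_induct)
    case zero
    then show ?case using w s by (simp add: zero_mult)
  next
    case (add p a r)
    have "(mon a p \<otimes>\<^bsub>algebra\<^esub> w) \<otimes>\<^bsub>algebra\<^esub> s \<in> K"
      using s
    proof (induction rule: algebra_induct)
      case zero
      then show ?case using w add by (simp add: mult_zero mult_closed monomial_closed)
    next
      case (add q b s)
      then show ?case
        using w monomials \<open>p \<in> mor G\<close> \<open>a \<in> _\<close> by (simp add: distrib_left mult_closed monomial_closed)
    qed
    then show ?case
      using w s add by (simp add: distrib_right mult_closed monomial_closed)
  qed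
qed

lemma monomial_mult3:
  assumes "p \<in> mor G" "m \<in> mor G" "q \<in> mor G" "a \<in> carrier (A (cod_of G p))"
    "c \<in> carrier (A (cod_of G m))" "b \<in> carrier (A (cod_of G q))"
  shows "(mon a p \<otimes>\<^bsub>algebra\<^esub> mon c m) \<otimes>\<^bsub>algebra\<^esub> mon b q =
    (if (p, m) \<in> composable G \<and> (m, q) \<in> composable G
     then mon (a \<otimes>\<^bsub>A (cod_of G p)\<^esub> \<sigma> p (c \<otimes>\<^bsub>A (cod_of G m)\<^esub> \<sigma> m b)) (ccomp G p (ccomp G m q))
     else \<zero>\<^bsub>algebra\<^esub>)"
proof (cases "(m, q) \<in> composable G")
  case True
  interpret M: ring "A (cod_of G m)" by (rule ring_cod) (use assms in simp)
  have "(p, ccomp G m q) \<in> composable G \<longleftrightarrow> (p, m) \<in> composable G"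
    using True assms by (auto simp: composable_def comp_mor cod_comp)
  then show ?thesis
    using True assms
    by (subst monomial_assoc) (auto simp: monomial_mult comp_mor cod_comp sigma_closed)
next
  case False
  then show ?thesis
    using assms by (subst monomial_assoc) (auto simp: monomial_mult mult_zero monomial_closed)
qed

lemma unit_at_coeff: "e \<in> ob G \<Longrightarrow> unit_at e e = \<one>\<^bsub>A e\<^esub>"
  by (simp add: monomial_coeff ob_in_mor)

text \<open>
  A product \<open>(a u\<^sub>p) u\<^sub>f (b u\<^sub>q)\<close> is supported at \<open>p q\<close>, a morphism that factors through \<open>f\<close>. If \<open>e\<close>
  does not factor through \<open>f\<close>, the coefficient at \<open>e\<close> always vanishes.
\<close>
lemma simple_imp_inverse_connected:
  assumes simple: "simple_ring algebra"
  shows "inverse_connected G"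
  unfolding inverse_connected_def
proof (intro ballI, rule ccontr)
  fix e f assume e: "e \<in> ob G" and f: "f \<in> ob G"
  assume no: "\<not> (\<exists>m\<in>mor G. \<exists>n\<in>mor G. dom_of G m = f \<and> cod_of G n = f \<and> ccomp G m n = e)"
  define K where "K = {x \<in> carrier algebra. x e = \<zero>\<^bsub>A e\<^esub>}"
  interpret E: ring "A e" by (rule ring_A[OF e])
  have em: "e \<in> mor G" "cod_of G e = e" using e by (auto simp: ob_in_mor ident_cod)
  have K: "additive_subgroup K algebra"
    using em by (intro alg.additive_subgroupI_closed) (auto simp: K_def)
  have "unit_at f = \<zero>\<^bsub>algebra\<^esub>"
  proof (rule simple_sandwich_eq_zero[OF simple K e _ unit_at_closed[OF f]])
    show "unit_at e \<notin> K"
      using e one_not_zero_A by (simp add: K_def unit_at_coeff)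
    fix r s assume rs: "r \<in> carrier algebra" "s \<in> carrier algebra"
    show "(r \<otimes>\<^bsub>algebra\<^esub> unit_at f) \<otimes>\<^bsub>algebra\<^esub> s \<in> K"
    proof (rule sandwich_by_monomials[OF K unit_at_closed[OF f] _ rs])
      fix p q a b
      assume pq: "p \<in> mor G" "q \<in> mor G"
        and ab: "a \<in> carrier (A (cod_of G p))" "b \<in> carrier (A (cod_of G q))"
      let ?t = "(mon a p \<otimes>\<^bsub>algebra\<^esub> unit_at f) \<otimes>\<^bsub>algebra\<^esub> mon b q"
      have tc: "?t \<in> carrier algebra"
        using pq ab f by (simp add: mult_closed monomial_closed unit_at_closed)
      have "?t e = \<zero>\<^bsub>A e\<^esub>"
      proof (cases "(p, f) \<in> composable G \<and> (f, q) \<in> composable G")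
        case True
        then have "dom_of G p = f" "cod_of G q = f"
          using f by (auto simp: composable_def ident_cod ident_dom)
        then have "ccomp G p (ccomp G f q) \<noteq> e"
          using no pq ident_left by fastforce
        then show ?thesis
          using pq ab f em by (simp add: monomial_mult3 ob_in_mor ident_cod one_closed_A monomial_coeff)
      next
        case False
        then show ?thesis
          using pq ab f em by (auto simp: monomial_mult3 ob_in_mor ident_cod one_closed_A)
      qed
      then show "?t \<in> K"
        using tc by (simp add: K_def)
    qed
  qed
  then show False
    using f unit_at_coeff[OF f] one_not_zero_A[OF f] by (simp add: ob_in_mor ident_cod)
qed

lemma vertex_mor: "n \<in> mor (vertex_monoid G e) \<longleftrightarrow> n \<in> mor G \<and> dom_of G n = e \<and> cod_of G n = e"
  by (simp add: vertex_monoid_def)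

text \<open>
  If \<open>(a u\<^sub>p) (j u\<^sub>e) (b u\<^sub>q)\<close> has a coefficient on \<open>G\<^sub>e\<close>, then \<open>p \<in> G\<^sub>e\<close> and that coefficient is
  \<open>a \<sigma>\<^sub>p(j b)\<close>, which stays in the invariant ideal.
\<close>
lemma simple_imp_vertex_simple:
  assumes simple: "simple_ring algebra" and e: "e \<in> ob G"
  shows "vertex_simple A G \<sigma> e"
  unfolding vertex_simple_def
proof
  assume "\<exists>J. nontrivial_ideal J (A e) \<and> (\<forall>n\<in>mor (vertex_monoid G e). \<sigma> n ` J \<subseteq> J)"
  then obtain J where J: "nontrivial_ideal J (A e)"
    and inv: "\<And>n j. \<lbrakk>n \<in> mor (vertex_monoid G e); j \<in> J\<rbrakk> \<Longrightarrow> \<sigma> n j \<in> J"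
    by blast
  interpret E: ring "A e" by (rule ring_A[OF e])
  have JI: "two_sided_ideal J (A e)"
    using J by (simp add: nontrivial_ideal_def)
  note JD = two_sided_idealD[OF JI E.abelian_group_axioms]
  have em: "e \<in> mor G" "cod_of G e = e" using e by (auto simp: ob_in_mor ident_cod)
  obtain j where j: "j \<in> J" "j \<noteq> \<zero>\<^bsub>A e\<^esub>"
    using J JD(2) by (auto simp: nontrivial_ideal_def)
  then have jc: "j \<in> carrier (A e)" using JD(1) by auto
  have one: "\<one>\<^bsub>A e\<^esub> \<notin> J"
    using J E.one_in_ideal by (auto simp: nontrivial_ideal_def)
  define K where "K = {x \<in> carrier algebra. \<forall>n\<in>mor (vertex_monoid G e). x n \<in> J}"
  have K: "additive_subgroup K algebra"
    by (intro alg.additive_subgroupI_closed) (auto simp: K_def JD vertex_mor)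
  have wc: "mon j e \<in> carrier algebra"
    using em jc by (simp add: monomial_closed)
  have "mon j e = \<zero>\<^bsub>algebra\<^esub>"
  proof (rule simple_sandwich_eq_zero[OF simple K e _ wc])
    show "unit_at e \<notin> K"
      using e em one unit_at_coeff[OF e] by (auto simp: K_def vertex_mor ident_dom intro!: bexI[of _ e])
    fix r s assume rs: "r \<in> carrier algebra" "s \<in> carrier algebra"
    show "(r \<otimes>\<^bsub>algebra\<^esub> mon j e) \<otimes>\<^bsub>algebra\<^esub> s \<in> K"
    proof (rule sandwich_by_monomials[OF K wc _ rs])
      fix p q a b
      assume pq: "p \<in> mor G" "q \<in> mor G"
        and ab: "a \<in> carrier (A (cod_of G p))" "b \<in> carrier (A (cod_of G q))"
      let ?t = "(mon a p \<otimes>\<^bsub>algebra\<^esub> mon j e) \<otimes>\<^bsub>algebra\<^esub> mon b q"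
      have tc: "?t \<in> carrier algebra"
        using pq ab wc by (simp add: mult_closed monomial_closed)
      have "?t n \<in> J" if n: "n \<in> mor (vertex_monoid G e)" for n
      proof (cases "(p, e) \<in> composable G \<and> (e, q) \<in> composable G \<and> n = ccomp G p (ccomp G e q)")
        case True
        then have *: "dom_of G p = e" "cod_of G q = e"
          using e by (auto simp: composable_def ident_cod ident_dom)
        then have "ccomp G e q = q"
          using ident_left pq by fastforce
        then have cp: "cod_of G p = e"
          using n True pq * by (auto simp: vertex_mor cod_comp composable_def)
        have "j \<otimes>\<^bsub>A e\<^esub> \<sigma> e b \<in> J"
          using ab * j e by (simp add: sigma_ident JD)
        then have "a \<otimes>\<^bsub>A e\<^esub> \<sigma> p (j \<otimes>\<^bsub>A e\<^esub> \<sigma> e b) \<in> J"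
          using ab cp pq * by (simp add: inv JD vertex_mor)
        then show ?thesis
          using True n pq ab em jc cp by (simp add: monomial_mult3 monomial_coeff vertex_mor)
      next
        case False
        then show ?thesis
          using n pq ab em jc by (auto simp: monomial_mult3 monomial_coeff vertex_mor JD)
      qed
      then show "?t \<in> K"
        using tc by (simp add: K_def)
    qed
  qed
  then have "mon j e e = \<zero>\<^bsub>A e\<^esub>"
    using em by simp
  then show False
    using j(2) em by (simp add: monomial_coeff)
qed

text \<open>
  The sum of the coefficients on \<open>G\<^sub>e\<close>, restricted to the support because \<open>finsum\<close> over an infinite
  set is zero by convention.
\<close>
definition augmentation :: "'m \<Rightarrow> ('m \<Rightarrow> 'a) \<Rightarrow> 'a" where
  "augmentation e x = finsum (A e) x (supp x \<inter> mor (vertex_monoid G e))"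

lemma augmentation_finsum:
  assumes e: "e \<in> ob G" and x: "x \<in> carrier algebra"
    and S: "finite S" "S \<subseteq> mor (vertex_monoid G e)" "supp x \<inter> mor (vertex_monoid G e) \<subseteq> S"
  shows "augmentation e x = finsum (A e) x S"
proof -
  interpret E: ring "A e" by (rule ring_A[OF e])
  show ?thesis
    unfolding augmentation_def
  proof (rule E.add.finprod_mono_neutral_cong_left[OF S(1,3)])
    show "x i = \<zero>\<^bsub>A e\<^esub>" if "i \<in> S - supp x \<inter> mor (vertex_monoid G e)" for i
      using that S(2) by (auto simp: supp_def vertex_mor)
    show "x \<in> S \<rightarrow> carrier (A e)"
      using S(2) coeff_closed[OF x] by (force simp: vertex_mor)
  qed simp
qed

lemma augmentation_add:
  assumes e: "e \<in> ob G" and x: "x \<in> carrier algebra" and y: "y \<in> carrier algebra"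
  shows "augmentation e (x \<oplus>\<^bsub>algebra\<^esub> y) = augmentation e x \<oplus>\<^bsub>A e\<^esub> augmentation e y"
proof -
  interpret E: ring "A e" by (rule ring_A[OF e])
  let ?S = "(supp x \<union> supp y \<union> supp (x \<oplus>\<^bsub>algebra\<^esub> y)) \<inter> mor (vertex_monoid G e)"
  have fin: "finite ?S"
    using x y by (auto simp: finite_supp)
  have eq: "augmentation e u = finsum (A e) u ?S" if "u \<in> {x, y, x \<oplus>\<^bsub>algebra\<^esub> y}" for u
    using that x y fin by (intro augmentation_finsum[OF e]) auto
  have c: "u \<in> ?S \<rightarrow> carrier (A e)" if "u \<in> carrier algebra" for u
    using coeff_closed[OF that] by (force simp: vertex_mor)
  have "finsum (A e) (x \<oplus>\<^bsub>algebra\<^esub> y) ?S = finsum (A e) (\<lambda>n. x n \<oplus>\<^bsub>A e\<^esub> y n) ?S"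
    by (rule E.finsum_cong') (use c[OF x] c[OF y] in \<open>auto simp: vertex_mor\<close>)
  also have "\<dots> = finsum (A e) x ?S \<oplus>\<^bsub>A e\<^esub> finsum (A e) y ?S"
    by (rule E.finsum_addf[OF c[OF x] c[OF y]])
  finally show ?thesis
    by (simp add: eq)
qed

lemma augmentation_monomial:
  assumes e: "e \<in> ob G" and k: "k \<in> mor G" and a: "a \<in> carrier (A (cod_of G k))"
  shows "augmentation e (mon a k) = (if k \<in> mor (vertex_monoid G e) then a else \<zero>\<^bsub>A e\<^esub>)"
proof -
  interpret E: ring "A e" by (rule ring_A[OF e])
  note supp = supp_monomial[of a k]
  show ?thesis
  proof (cases "k \<in> mor (vertex_monoid G e)")
    case True
    then have "augmentation e (mon a k) = finsum (A e) (mon a k) (insert k {})"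
      using supp by (intro augmentation_finsum[OF e monomial_closed[OF k a]]) auto
    also have "\<dots> = a"
      using True a k by (subst E.finsum_insert) (auto simp: monomial_coeff vertex_mor)
    finally show ?thesis using True by simp
  next
    case False
    then have "supp (mon a k) \<inter> mor (vertex_monoid G e) = {}"
      using supp by auto
    then show ?thesis
      using False by (simp add: augmentation_def)
  qed
qed

text \<open>
  The element \<open>w = r u\<^sub>m - r u\<^sub>n\<close> satisfies
  \<open>(a u\<^sub>p) w (b u\<^sub>q) = c u\<^bsub>pmq\<^esub> - c u\<^bsub>pnq\<^esub>\<close> with \<open>c = a \<sigma>\<^sub>p(r \<sigma>\<^sub>m(b)) = a \<sigma>\<^sub>p(r \<sigma>\<^sub>n(b))\<close>. The
  morphisms \<open>pmq\<close> and \<open>pnq\<close> have the same domain and codomain, so either both terms lie on \<open>G\<^sub>e\<close> or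
  neither does, and the augmentation is zero in both cases.
  A coefficient \<open>r\<close> other than \<open>1\<close> is allowed because the rings \<open>A e\<close> may have zero divisors: that an element commutes with \<open>A\<close> says only that \<open>\<sigma>\<^sub>m\<close> and
  \<open>\<sigma>\<^sub>n\<close> agree up to the factor \<open>r\<close>.
\<close>
lemma simple_imp_faithful:
  assumes simple: "simple_ring algebra" and e: "e \<in> ob G"
    and m: "m \<in> mor (vertex_monoid G e)" and n: "n \<in> mor (vertex_monoid G e)" and neq: "m \<noteq> n"
    and r: "r \<in> carrier (A e)"
    and eq: "\<And>b. b \<in> carrier (A e) \<Longrightarrow> r \<otimes>\<^bsub>A e\<^esub> \<sigma> m b = r \<otimes>\<^bsub>A e\<^esub> \<sigma> n b"
  shows "r = \<zero>\<^bsub>A e\<^esub>"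
proof -
  interpret E: ring "A e" by (rule ring_A[OF e])
  have em: "e \<in> mor G" "cod_of G e = e" using e by (auto simp: ob_in_mor ident_cod)
  have mm: "m \<in> mor G" "dom_of G m = e" "cod_of G m = e"
    and nm: "n \<in> mor G" "dom_of G n = e" "cod_of G n = e"
    using m n by (auto simp: vertex_mor)
  define K where "K = {x \<in> carrier algebra. augmentation e x = \<zero>\<^bsub>A e\<^esub>}"
  have K: "additive_subgroup K algebra"
  proof (rule alg.additive_subgroupI_closed)
    show zero: "\<zero>\<^bsub>algebra\<^esub> \<in> K"
      by (simp add: K_def augmentation_def zero_closed)
    show "x \<oplus>\<^bsub>algebra\<^esub> y \<in> K" if "x \<in> K" "y \<in> K" for x y
      using that by (simp add: K_def augmentation_add[OF e])
    show "\<ominus>\<^bsub>algebra\<^esub> x \<in> K" if x: "x \<in> K" for x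
    proof -
      have xc: "x \<in> carrier algebra" "augmentation e x = \<zero>\<^bsub>A e\<^esub>"
        using x by (auto simp: K_def)
      have "augmentation e (\<ominus>\<^bsub>algebra\<^esub> x) \<in> carrier (A e)"
        unfolding augmentation_def
        by (rule E.finsum_closed) (use coeff_closed[of "\<ominus>\<^bsub>algebra\<^esub> x"] xc in \<open>force simp: vertex_mor\<close>)
      moreover have "augmentation e (\<ominus>\<^bsub>algebra\<^esub> x \<oplus>\<^bsub>algebra\<^esub> x) = \<zero>\<^bsub>A e\<^esub>"
        using xc zero by (simp add: alg.l_neg K_def)
      ultimately show ?thesis
        using xc by (simp add: K_def augmentation_add[OF e])
    qed
  qed (auto simp: K_def)
  define w where "w = mon r m \<oplus>\<^bsub>algebra\<^esub> mon (\<ominus>\<^bsub>A e\<^esub> r) n"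
  have terms: "mon r m \<in> carrier algebra" "mon (\<ominus>\<^bsub>A e\<^esub> r) n \<in> carrier algebra"
    using mm nm r by (simp_all add: monomial_closed)
  then have wc: "w \<in> carrier algebra"
    by (simp add: w_def)
  have "w = \<zero>\<^bsub>algebra\<^esub>"
  proof (rule simple_sandwich_eq_zero[OF simple K e _ wc])
    show "unit_at e \<notin> K"
      using e em one_not_zero_A by (simp add: K_def augmentation_monomial vertex_mor ident_dom)
    fix x y assume xy: "x \<in> carrier algebra" "y \<in> carrier algebra"
    show "(x \<otimes>\<^bsub>algebra\<^esub> w) \<otimes>\<^bsub>algebra\<^esub> y \<in> K"
    proof (rule sandwich_by_monomials[OF K wc _ xy])
      fix p q a b
      assume pq: "p \<in> mor G" "q \<in> mor G"
        and ab: "a \<in> carrier (A (cod_of G p))" "b \<in> carrier (A (cod_of G q))"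
      interpret P: ring "A (cod_of G p)" by (rule ring_cod[OF pq(1)])
      let ?t = "(mon a p \<otimes>\<^bsub>algebra\<^esub> w) \<otimes>\<^bsub>algebra\<^esub> mon b q"
      have tc: "?t \<in> carrier algebra"
        using pq ab wc by (simp add: mult_closed monomial_closed)
      have t: "?t = (mon a p \<otimes>\<^bsub>algebra\<^esub> mon r m) \<otimes>\<^bsub>algebra\<^esub> mon b q
          \<oplus>\<^bsub>algebra\<^esub> (mon a p \<otimes>\<^bsub>algebra\<^esub> mon (\<ominus>\<^bsub>A e\<^esub> r) n) \<otimes>\<^bsub>algebra\<^esub> mon b q"
        unfolding w_def using terms pq ab
        by (simp add: distrib_left distrib_right mult_closed monomial_closed)
      show "?t \<in> K"
      proof (cases "dom_of G p = e \<and> cod_of G q = e")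
        case True
        define c where "c = a \<otimes>\<^bsub>A (cod_of G p)\<^esub> \<sigma> p (r \<otimes>\<^bsub>A e\<^esub> \<sigma> n b)"
        have comp: "(p, m) \<in> composable G" "(m, q) \<in> composable G"
            "(p, n) \<in> composable G" "(n, q) \<in> composable G"
          using True pq mm nm by (auto simp: composable_def)
        then have comp': "(p, ccomp G m q) \<in> composable G" "(p, ccomp G n q) \<in> composable G"
          by (auto simp: composable_def comp_mor cod_comp)
        have b: "b \<in> carrier (A e)"
          using ab True by simp
        have nb: "\<sigma> n b \<in> carrier (A e)"
          using sigma_closed[OF comp(4)] ab nm by simp
        have hom: "\<sigma> p \<in> ring_hom (A e) (A (cod_of G p))"
          using sigma_hom[OF pq(1)] True by simp
        have closed: "\<sigma> p (r \<otimes>\<^bsub>A e\<^esub> \<sigma> n b) \<in> carrier (A (cod_of G p))"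
          using ring_hom_closed[OF hom] r nb by simp
        then have c: "c \<in> carrier (A (cod_of G p))"
          using ab by (simp add: c_def)
        have "\<sigma> p ((\<ominus>\<^bsub>A e\<^esub> r) \<otimes>\<^bsub>A e\<^esub> \<sigma> n b) = \<ominus>\<^bsub>A (cod_of G p)\<^esub> \<sigma> p (r \<otimes>\<^bsub>A e\<^esub> \<sigma> n b)"
        proof -
          interpret h: ring_hom_ring "A e" "A (cod_of G p)" "\<sigma> p"
            by (rule ring_hom_ringI2) (use hom E.ring_axioms P.ring_axioms in auto)
          show ?thesis
            using r nb by (simp add: E.l_minus del: h.hom_mult)
        qed
        then have n_term: "(mon a p \<otimes>\<^bsub>algebra\<^esub> mon (\<ominus>\<^bsub>A e\<^esub> r) n) \<otimes>\<^bsub>algebra\<^esub> mon b q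
            = mon (\<ominus>\<^bsub>A (cod_of G p)\<^esub> c) (ccomp G p (ccomp G n q))"
          using comp pq nm ab r closed by (simp add: monomial_mult3 c_def P.r_minus)
        have m_term: "(mon a p \<otimes>\<^bsub>algebra\<^esub> mon r m) \<otimes>\<^bsub>algebra\<^esub> mon b q
            = mon c (ccomp G p (ccomp G m q))"
          using comp pq mm ab r eq[OF b] by (simp add: monomial_mult3 c_def)
        have same: "ccomp G p (ccomp G n q) \<in> mor (vertex_monoid G e)
            \<longleftrightarrow> ccomp G p (ccomp G m q) \<in> mor (vertex_monoid G e)"
          using comp comp' by (simp add: vertex_mor comp_mor cod_comp dom_comp)
        have cods: "cod_of G (ccomp G p (ccomp G m q)) = cod_of G p" "cod_of G (ccomp G p (ccomp G n q)) = cod_of G p"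
            "ccomp G p (ccomp G m q) \<in> mor G" "ccomp G p (ccomp G n q) \<in> mor G"
          using comp' by (simp_all add: cod_comp comp_mor)
        have in_e: "cod_of G p = e" if "ccomp G p (ccomp G m q) \<in> mor (vertex_monoid G e)"
          using that cods by (simp add: vertex_mor)
        have cl: "mon c (ccomp G p (ccomp G m q)) \<in> carrier algebra"
            "mon (\<ominus>\<^bsub>A (cod_of G p)\<^esub> c) (ccomp G p (ccomp G n q)) \<in> carrier algebra"
          using c cods by (simp_all add: monomial_closed)
        have "augmentation e ?t = \<zero>\<^bsub>A e\<^esub>"
          unfolding t m_term n_term augmentation_add[OF e cl]
          using c cods same in_e by (auto simp: augmentation_monomial[OF e] E.r_neg)
        then show ?thesis
          using tc by (simp add: K_def)
      next
        case False
        then have "?t = \<zero>\<^bsub>algebra\<^esub>"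
          unfolding t using pq ab mm nm r by (auto simp: monomial_mult3 composable_def zero_closed)
        then show ?thesis
          using additive_subgroup.zero_closed[OF K] by simp
      qed
    qed
  qed
  then have "w m = \<zero>\<^bsub>A e\<^esub>"
    using mm by simp
  then show ?thesis
    using mm r neq by (simp add: w_def monomial_coeff)
qed

lemma simple_imp_kernel_locally_trivial:
  assumes simple: "simple_ring algebra"
  shows "kernel_locally_trivial A G \<sigma>"
  unfolding kernel_locally_trivial_def
proof (intro ballI impI, rule ccontr)
  fix e m n
  assume e: "e \<in> ob G" and mn: "m \<in> mor (vertex_monoid G e)" "n \<in> mor (vertex_monoid G e)" "m \<noteq> n"
    and eq: "\<forall>a\<in>carrier (A e). \<sigma> m a = \<sigma> n a"
  show False
    using simple_imp_faithful[OF simple e mn one_closed_A[OF e]] eq one_not_zero_A[OF e] by auto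
qed

end

section \<open>The corner ring at an object\<close>

context skew_category_system
begin

lemma vertex_composable:
  "(m, n) \<in> composable (vertex_monoid G e) \<longleftrightarrow> m \<in> mor (vertex_monoid G e) \<and> n \<in> mor (vertex_monoid G e)"
  by (auto simp: composable_def vertex_monoid_def)

lemma vertex_composable_imp:
  "(m, n) \<in> composable (vertex_monoid G e) \<Longrightarrow> (m, n) \<in> composable G"
  by (auto simp: composable_def vertex_monoid_def)

lemma vertex_sel [simp]:
  "ob (vertex_monoid G e) = {e}" "dom_of (vertex_monoid G e) = dom_of G"
  "cod_of (vertex_monoid G e) = cod_of G" "ccomp (vertex_monoid G e) = ccomp G"
  by (simp_all add: vertex_monoid_def)

lemma vertex_system:
  assumes e: "e \<in> ob G"
  shows "skew_category_system A (vertex_monoid G e) \<sigma>"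
proof (intro skew_category_system.intro small_category.intro skew_category_system_axioms.intro)
  let ?V = "vertex_monoid G e"
  show "ob ?V \<subseteq> mor ?V"
    using e by (auto simp: vertex_mor ob_in_mor ident_dom ident_cod)
  fix m n assume mn: "(m, n) \<in> composable ?V"
  note c = vertex_composable_imp[OF mn]
  show "ccomp ?V m n \<in> mor ?V" "dom_of ?V (ccomp ?V m n) = dom_of ?V n"
    "cod_of ?V (ccomp ?V m n) = cod_of ?V m"
    using mn c by (auto simp: vertex_mor vertex_composable comp_mor dom_comp cod_comp)
  show "\<sigma> m (\<sigma> n a) = \<sigma> (ccomp ?V m n) a" if "a \<in> carrier (A (dom_of ?V n))" for a
    using sigma_comp[OF c] that by simp
  show "ccomp ?V (ccomp ?V l m) n = ccomp ?V l (ccomp ?V m n)" if "(l, m) \<in> composable ?V" for l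
    using comp_assoc[OF vertex_composable_imp[OF that] c] by simp
qed (use e in \<open>auto simp: vertex_mor ident_dom ident_cod ident_left ident_right ring_A
      one_not_zero_A sigma_hom sigma_ident dest: sigma_hom ident_left ident_right\<close>)

text \<open>
  The corner \<open>u\<^sub>e (A \<rtimes> G) u\<^sub>e\<close> is identified with the algebra \<open>A\<^sub>e \<rtimes> G\<^sub>e\<close>, and the compression
  \<open>x \<mapsto> u\<^sub>e x u\<^sub>e\<close> with the restriction of families to \<open>G\<^sub>e\<close>.
\<close>
abbreviation corner :: "'m \<Rightarrow> ('m \<Rightarrow> 'a) ring" where
  "corner e \<equiv> skew_category_algebra A (vertex_monoid G e) \<sigma>"

abbreviation compress :: "'m \<Rightarrow> ('m \<Rightarrow> 'a) \<Rightarrow> 'm \<Rightarrow> 'a" where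
  "compress e x \<equiv> restrict x (mor (vertex_monoid G e))"

lemma compress_closed:
  assumes e: "e \<in> ob G" and x: "x \<in> carrier algebra"
  shows "compress e x \<in> carrier (corner e)"
proof -
  interpret V: skew_category_system A "vertex_monoid G e" \<sigma> by (rule vertex_system[OF e])
  show ?thesis
  proof (rule V.algebraI[OF _ _ finite_supp[OF x]])
    show "V.supp (compress e x) \<subseteq> supp x"
      by (auto simp: V.supp_def supp_def vertex_mor)
    show "compress e x n \<in> carrier (A (cod_of (vertex_monoid G e) n))"
      if n: "n \<in> mor (vertex_monoid G e)" for n
      using n coeff_closed[OF x, of n] by (simp add: vertex_mor)
  qed simp
qed

text \<open>
  Compression is not multiplicative, since a product of two morphisms outside \<open>G\<^sub>e\<close> may lie in \<open>G\<^sub>e\<close>.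
  It is so when every contributing factorization passes through \<open>e\<close>: the two factors of a morphism
  in \<open>G\<^sub>e\<close> are then themselves in \<open>G\<^sub>e\<close>.
\<close>
lemma compress_mult:
  assumes e: "e \<in> ob G" and x: "x \<in> carrier algebra" and y: "y \<in> carrier algebra"
    and middle: "(\<forall>n\<in>supp x. dom_of G n = e) \<or> (\<forall>n\<in>supp y. cod_of G n = e)"
  shows "compress e (x \<otimes>\<^bsub>algebra\<^esub> y) = compress e x \<otimes>\<^bsub>corner e\<^esub> compress e y"
proof
  fix p
  let ?V = "vertex_monoid G e"
  show "compress e (x \<otimes>\<^bsub>algebra\<^esub> y) p = (compress e x \<otimes>\<^bsub>corner e\<^esub> compress e y) p"
  proof (cases "p \<in> mor ?V")
    case True
    then have p: "p \<in> mor G" "dom_of G p = e" "cod_of G p = e"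
      by (auto simp: vertex_mor)
    interpret C: ring "A e" by (rule ring_A[OF e])
    let ?S = "{(m, n) \<in> composable G. ccomp G m n = p \<and>
          x m \<noteq> \<zero>\<^bsub>A (cod_of G m)\<^esub> \<and> y n \<noteq> \<zero>\<^bsub>A (cod_of G n)\<^esub>}"
    let ?T = "{(m, n) \<in> composable ?V. ccomp ?V m n = p \<and>
          compress e x m \<noteq> \<zero>\<^bsub>A (cod_of ?V m)\<^esub> \<and> compress e y n \<noteq> \<zero>\<^bsub>A (cod_of ?V n)\<^esub>}"
    have in_V: "m \<in> mor ?V \<and> n \<in> mor ?V" if "(m, n) \<in> ?S" for m n
    proof -
      have mn: "(m, n) \<in> composable G" "ccomp G m n = p" "m \<in> supp x" "n \<in> supp y"
        using that composableD by (auto simp: supp_def)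
      have "dom_of G m = e" "cod_of G n = e"
        using middle mn composableD(3)[OF mn(1)] by auto
      moreover have "cod_of G m = e" "dom_of G n = e"
        using mn p cod_comp[OF mn(1)] dom_comp[OF mn(1)] by auto
      ultimately show ?thesis
        using composableD[OF mn(1)] by (simp add: vertex_mor)
    qed
    have "?S = ?T"
    proof (rule Set.set_eqI)
      fix i :: "'m \<times> 'm"
      obtain m n where i: "i = (m, n)" by (cases i)
      show "i \<in> ?S \<longleftrightarrow> i \<in> ?T"
      proof (cases "m \<in> mor ?V \<and> n \<in> mor ?V")
        case True
        then have V: "(m, n) \<in> composable ?V"
          by (simp add: vertex_composable)
        show ?thesis
          using True V vertex_composable_imp[OF V] by (simp add: i)
      next
        case False
        then have "i \<notin> ?S" "i \<notin> ?T"
          unfolding i using in_V[of m n] vertex_composable[of m n e] by blast+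
        then show ?thesis by simp
      qed
    qed
    moreover have "(case i of (m, n) \<Rightarrow> x m \<otimes>\<^bsub>A e\<^esub> \<sigma> m (y n)) \<in> carrier (A e)" if "i \<in> ?S" for i
    proof -
      obtain m n where i: "i = (m, n)" by (cases i)
      then have "m \<in> mor ?V" "n \<in> mor ?V" "(m, n) \<in> composable G"
        using that in_V by auto
      then show ?thesis
        using i sigma_closed[of m n "y n"] coeff_closed[OF x, of m] coeff_closed[OF y, of n]
        by (simp add: vertex_mor)
    qed
    ultimately have "finsum (A e) (\<lambda>(m, n). x m \<otimes>\<^bsub>A e\<^esub> \<sigma> m (y n)) ?S
        = finsum (A e) (\<lambda>(m, n). compress e x m \<otimes>\<^bsub>A e\<^esub> \<sigma> m (compress e y n)) ?T"
      by (intro C.finsum_cong') (auto simp: vertex_composable)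
    then show ?thesis
      using True p by (simp add: skew_category_algebra_def skew_mult_def)
  next
    case False
    then show ?thesis
      by (simp add: skew_category_algebra_def skew_mult_def)
  qed
qed

text \<open>
  An element \<open>z\<close> of an ideal \<open>I\<close> of the corner, extended by zero to \<open>w\<close>, satisfies
  \<open>u\<^sub>e (r w s) u\<^sub>e = (u\<^sub>e r u\<^sub>e) z (u\<^sub>e s u\<^sub>e) \<in> I\<close>.
\<close>
lemma simple_imp_corner_simple:
  assumes simple: "simple_ring algebra" and e: "e \<in> ob G"
  shows "simple_ring (corner e)"
  unfolding simple_ring_def
proof
  let ?V = "vertex_monoid G e"
  interpret V: skew_category_system A ?V \<sigma> by (rule vertex_system[OF e])
  interpret S: ring "corner e" by (rule V.ring_algebra) simp
  assume "\<exists>I. nontrivial_ideal I (corner e)"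
  then obtain I where I: "two_sided_ideal I (corner e)" "I \<noteq> carrier (corner e)" "I \<noteq> {\<zero>\<^bsub>corner e\<^esub>}"
    by (auto simp: nontrivial_ideal_def)
  note ID = two_sided_idealD[OF I(1) V.abelian_group_algebra]
  obtain z where z: "z \<in> I" "z \<noteq> \<zero>\<^bsub>corner e\<^esub>"
    using I(3) ID(2) by auto
  then have zc: "z \<in> carrier (corner e)"
    using ID(1) by auto
  define w where "w = (\<lambda>n\<in>mor G. if n \<in> mor ?V then z n else \<zero>\<^bsub>A (cod_of G n)\<^esub>)"
  have sw: "supp w \<subseteq> V.supp z"
    by (auto simp: supp_def w_def V.supp_def)
  have w: "w \<in> carrier algebra"
  proof (rule algebraI[OF _ _ V.finite_supp[OF zc] sw])
    show "w n \<in> carrier (A (cod_of G n))" if "n \<in> mor G" for n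
      using that V.coeff_closed[OF zc, of n] by (simp add: w_def cod_zero_closed)
  qed (simp add: w_def)
  have cw: "compress e w = z"
    by (rule V.algebra_eqI[OF compress_closed[OF e w] zc]) (simp add: w_def vertex_mor)
  have supp_w: "dom_of G n = e" "cod_of G n = e" if "n \<in> supp w" for n
    using that sw by (auto simp: V.supp_def vertex_mor)
  define K where "K = {x \<in> carrier algebra. compress e x \<in> I}"
  have K: "additive_subgroup K algebra"
  proof (rule alg.additive_subgroupI_closed)
    have "compress e \<zero>\<^bsub>algebra\<^esub> = \<zero>\<^bsub>corner e\<^esub>"
      by (rule V.algebra_eqI[OF compress_closed[OF e zero_closed] V.zero_closed]) (simp add: vertex_mor)
    then show "\<zero>\<^bsub>algebra\<^esub> \<in> K"
      using ID(2) by (simp add: K_def)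
    show "x \<oplus>\<^bsub>algebra\<^esub> y \<in> K" if "x \<in> K" "y \<in> K" for x y
    proof -
      have xy: "x \<in> carrier algebra" "y \<in> carrier algebra" "compress e x \<in> I" "compress e y \<in> I"
        using that by (auto simp: K_def)
      have "compress e (x \<oplus>\<^bsub>algebra\<^esub> y) = compress e x \<oplus>\<^bsub>corner e\<^esub> compress e y"
        using xy by (intro V.algebra_eqI compress_closed[OF e] V.add_closed) (auto simp: vertex_mor)
      then show ?thesis
        using xy ID(3) by (simp add: K_def)
    qed
    show "\<ominus>\<^bsub>algebra\<^esub> x \<in> K" if "x \<in> K" for x
    proof -
      have x: "x \<in> carrier algebra" "compress e x \<in> I"
        using that by (auto simp: K_def)
      have "compress e (\<ominus>\<^bsub>algebra\<^esub> x) = \<ominus>\<^bsub>corner e\<^esub> (compress e x)"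
        using x by (intro V.algebra_eqI compress_closed[OF e] V.alg.a_inv_closed)
          (auto simp: vertex_mor compress_closed[OF e])
      then show ?thesis
        using x ID(4) by (simp add: K_def)
    qed
  qed (auto simp: K_def)
  have "w = \<zero>\<^bsub>algebra\<^esub>"
  proof (rule simple_sandwich_eq_zero[OF simple K e _ w])
    have "compress e (unit_at e) = \<one>\<^bsub>corner e\<^esub>"
      by (rule V.algebra_eqI[OF compress_closed[OF e unit_at_closed[OF e]] S.one_closed])
        (auto simp: skew_category_algebra_def monomial_coeff vertex_mor)
    then show "unit_at e \<notin> K"
      using S.one_in_ideal[OF I(1)] I(2) by (auto simp: K_def)
    fix r s assume rs: "r \<in> carrier algebra" "s \<in> carrier algebra"
    have "dom_of G n = e" if "n \<in> supp (r \<otimes>\<^bsub>algebra\<^esub> w)" for n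
      using that supp_mult[of r w] supp_w by (auto simp: dom_comp)
    then have "compress e ((r \<otimes>\<^bsub>algebra\<^esub> w) \<otimes>\<^bsub>algebra\<^esub> s)
        = compress e (r \<otimes>\<^bsub>algebra\<^esub> w) \<otimes>\<^bsub>corner e\<^esub> compress e s"
      using rs w by (intro compress_mult[OF e]) (auto simp: mult_closed)
    also have "compress e (r \<otimes>\<^bsub>algebra\<^esub> w) = compress e r \<otimes>\<^bsub>corner e\<^esub> z"
      using compress_mult[OF e rs(1) w] supp_w cw by auto
    finally have "compress e ((r \<otimes>\<^bsub>algebra\<^esub> w) \<otimes>\<^bsub>algebra\<^esub> s) \<in> I"
      using ID(6)[OF ID(5)[OF z(1) compress_closed[OF e rs(1)]] compress_closed[OF e rs(2)]] by (simp only:)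
    then show "(r \<otimes>\<^bsub>algebra\<^esub> w) \<otimes>\<^bsub>algebra\<^esub> s \<in> K"
      using rs w unfolding K_def by (blast intro: mult_closed)
  qed
  then have "z = \<zero>\<^bsub>corner e\<^esub>"
    using cw zc by (intro V.algebra_eqI V.zero_closed) (auto simp: vertex_mor)
  then show False
    using z by simp
qed

lemma simple_imp_center_field:
  assumes simple: "simple_ring algebra" and e: "e \<in> ob G"
  shows "field (center_ring (corner e))"
proof -
  interpret V: skew_category_system A "vertex_monoid G e" \<sigma> by (rule vertex_system[OF e])
  interpret S: ring "corner e" by (rule V.ring_algebra) simp
  have "\<one>\<^bsub>corner e\<^esub> e \<noteq> \<zero>\<^bsub>corner e\<^esub> e"
    using e by (simp add: skew_category_algebra_def vertex_mor ob_in_mor ident_dom ident_cod one_not_zero_A)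
  then have "\<one>\<^bsub>corner e\<^esub> \<noteq> \<zero>\<^bsub>corner e\<^esub>"
    by metis
  then show ?thesis
    by (rule S.center_of_simple_is_field[OF simple_imp_corner_simple[OF simple e]])
qed

section \<open>Maximal commutativity of the coefficient ring\<close>

text \<open>
  This description of the copy of \<open>A\<close> makes it an instance of the formulas for elements supported on
  identities.
\<close>
lemma base_subring_eq: "base_subring A G = {x \<in> carrier algebra. supp x \<subseteq> ob G}"
proof (intro equalityI subsetI)
  fix x assume "x \<in> base_subring A G"
  then obtain y where y: "y \<in> (\<Pi>\<^sub>E i\<in>ob G. carrier (A i))"
      "finite {i \<in> ob G. y i \<noteq> \<zero>\<^bsub>A i\<^esub>}" and x: "x = base_embedding A G y"
    by (auto simp: base_subring_def direct_sum_def)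
  have supp: "supp x \<subseteq> {i \<in> ob G. y i \<noteq> \<zero>\<^bsub>A i\<^esub>}"
    by (auto simp: supp_def x base_embedding_def ident_cod split: if_splits)
  have "x \<in> carrier algebra"
  proof (rule algebraI[OF _ _ y(2) supp])
    show "x n \<in> carrier (A (cod_of G n))" if "n \<in> mor G" for n
      using that y(1) by (auto simp: x base_embedding_def cod_zero_closed ident_cod)
  qed (simp add: x base_embedding_def)
  then show "x \<in> {x \<in> carrier algebra. supp x \<subseteq> ob G}"
    using supp by auto
next
  fix x assume x: "x \<in> {x \<in> carrier algebra. supp x \<subseteq> ob G}"
  let ?y = "restrict x (ob G)"
  have "?y i \<in> carrier (A i)" if "i \<in> ob G" for i
    using that x coeff_closed[of x i] by (simp add: ob_in_mor ident_cod)
  moreover have "{i \<in> ob G. ?y i \<noteq> \<zero>\<^bsub>A i\<^esub>} \<subseteq> supp x"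
    by (auto simp: supp_def ob_in_mor ident_cod)
  ultimately have "?y \<in> carrier (direct_sum (ob G) A)"
    using x finite_subset[OF _ finite_supp] by (auto simp: direct_sum_def)
  moreover have "x = base_embedding A G ?y"
  proof
    fix n
    show "x n = base_embedding A G ?y n"
      using x by (auto simp: base_embedding_def supp_def carrier_iff PiE_iff extensional_def)
  qed
  ultimately show "x \<in> base_subring A G"
    by (auto simp: base_subring_def)
qed

lemma base_monomial:
  assumes e: "e \<in> ob G" and a: "a \<in> carrier (A e)"
  shows "mon a e \<in> base_subring A G"
proof -
  have "mon a e \<in> carrier algebra"
    using e a by (simp add: monomial_closed ob_in_mor ident_cod)
  then show ?thesis
    using e supp_monomial[of a e] by (auto simp: base_subring_eq)
qed

text \<open>
  Comparing \<open>a x\<close> with \<open>x a\<close> for \<open>a\<close> concentrated at the codomain of \<open>n\<close>: if the domain of \<open>n\<close> were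
  different, \<open>x a\<close> would vanish at \<open>n\<close> even for \<open>a = 1\<close>.
\<close>
lemma commutant_coeff:
  assumes x: "x \<in> commutant (base_subring A G) algebra" and n: "n \<in> supp x"
  shows "dom_of G n = cod_of G n"
    and "a \<in> carrier (A (cod_of G n)) \<Longrightarrow> a \<otimes>\<^bsub>A (cod_of G n)\<^esub> x n = x n \<otimes>\<^bsub>A (cod_of G n)\<^esub> \<sigma> n a"
proof -
  have nm: "n \<in> mor G" and nz: "x n \<noteq> \<zero>\<^bsub>A (cod_of G n)\<^esub>"
    using n by (auto simp: supp_def)
  interpret C: ring "A (cod_of G n)" by (rule ring_cod[OF nm])
  have xc: "x \<in> carrier algebra"
    using x by (simp add: commutant_def)
  have e: "cod_of G n \<in> ob G" using cod_ob[OF nm] .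
  have eq: "a \<otimes>\<^bsub>A (cod_of G n)\<^esub> x n = x n \<otimes>\<^bsub>A (cod_of G n)\<^esub> \<sigma> n (mon a (cod_of G n) (dom_of G n))"
    if a: "a \<in> carrier (A (cod_of G n))" for a
  proof -
    have b: "mon a (cod_of G n) \<in> base_subring A G"
      by (rule base_monomial[OF e a])
    then have b': "mon a (cod_of G n) \<in> carrier algebra" "supp (mon a (cod_of G n)) \<subseteq> ob G"
      by (auto simp: base_subring_eq)
    have "(mon a (cod_of G n) \<otimes>\<^bsub>algebra\<^esub> x) n = (x \<otimes>\<^bsub>algebra\<^esub> mon a (cod_of G n)) n"
      using x b by (simp add: commutant_def)
    then show ?thesis
      using e nm xc by (simp add: diagonal_mult_coeff[OF b'] mult_diagonal_coeff[OF b'] monomial_coeff ob_in_mor)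
  qed
  show de: "dom_of G n = cod_of G n"
  proof (rule ccontr)
    assume ne: "dom_of G n \<noteq> cod_of G n"
    have "(n, dom_of G n) \<in> composable G"
      using nm dom_ob ob_mor by (auto simp: composable_def ident_cod)
    then have s0: "\<sigma> n \<zero>\<^bsub>A (dom_of G n)\<^esub> = \<zero>\<^bsub>A (cod_of G n)\<^esub>"
      using sigma_zero dom_ob[OF nm] by (fastforce simp: ident_cod)
    have "x n = x n \<otimes>\<^bsub>A (cod_of G n)\<^esub> \<sigma> n \<zero>\<^bsub>A (dom_of G n)\<^esub>"
      using eq[OF C.one_closed] ne nm dom_ob[OF nm] coeff_closed[OF xc nm]
      by (simp add: monomial_coeff ob_in_mor ident_cod)
    then show False
      using nz s0 coeff_closed[OF xc nm] by simp
  qed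
  show "a \<otimes>\<^bsub>A (cod_of G n)\<^esub> x n = x n \<otimes>\<^bsub>A (cod_of G n)\<^esub> \<sigma> n a" if "a \<in> carrier (A (cod_of G n))"
    using eq[OF that] de e by (simp add: monomial_coeff ob_in_mor)
qed

lemma commutative_summand:
  assumes comm: "commutative_ring (direct_sum (ob G) A)" and e: "e \<in> ob G"
    and a: "a \<in> carrier (A e)" and b: "b \<in> carrier (A e)"
  shows "a \<otimes>\<^bsub>A e\<^esub> b = b \<otimes>\<^bsub>A e\<^esub> a"
proof -
  let ?d = "\<lambda>a. \<lambda>i\<in>ob G. if i = e then a else \<zero>\<^bsub>A i\<^esub>"
  have d: "?d a \<in> carrier (direct_sum (ob G) A)" if "a \<in> carrier (A e)" for a
  proof -
    have "{i \<in> ob G. ?d a i \<noteq> \<zero>\<^bsub>A i\<^esub>} \<subseteq> {e}"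
      by auto
    then have "finite {i \<in> ob G. ?d a i \<noteq> \<zero>\<^bsub>A i\<^esub>}"
      by (rule finite_subset) simp
    then show ?thesis
      using that ring_A by (auto simp: direct_sum_def ring.ring_simprules)
  qed
  have "(?d a \<otimes>\<^bsub>direct_sum (ob G) A\<^esub> ?d b) e = (?d b \<otimes>\<^bsub>direct_sum (ob G) A\<^esub> ?d a) e"
    using comm d[OF a] d[OF b] by (simp add: commutative_ring_def)
  then show ?thesis
    using e by (simp add: direct_sum_def)
qed

lemma simple_imp_maximal_commutative:
  assumes simple: "simple_ring algebra" and comm: "commutative_ring (direct_sum (ob G) A)"
  shows "maximal_commutative (base_subring A G) algebra"
  unfolding maximal_commutative_def
proof (intro equalityI subsetI)
  fix x assume x: "x \<in> commutant (base_subring A G) algebra"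
  then have xc: "x \<in> carrier algebra"
    by (simp add: commutant_def)
  have "n \<in> ob G" if n: "n \<in> supp x" for n
  proof (rule ccontr)
    assume nob: "n \<notin> ob G"
    have nm: "n \<in> mor G" and nz: "x n \<noteq> \<zero>\<^bsub>A (cod_of G n)\<^esub>"
      using n by (auto simp: supp_def)
    have e: "cod_of G n \<in> ob G" using cod_ob[OF nm] .
    have "x n = \<zero>\<^bsub>A (cod_of G n)\<^esub>"
    proof (rule simple_imp_faithful[OF simple e])
      show "n \<in> mor (vertex_monoid G (cod_of G n))"
        using nm commutant_coeff(1)[OF x n] by (simp add: vertex_mor)
      show "cod_of G n \<in> mor (vertex_monoid G (cod_of G n))"
        using e by (simp add: vertex_mor ob_in_mor ident_dom ident_cod)
      show "n \<noteq> cod_of G n"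
        using nob e by auto
      show "x n \<in> carrier (A (cod_of G n))"
        by (rule coeff_closed[OF xc nm])
      fix b assume b: "b \<in> carrier (A (cod_of G n))"
      show "x n \<otimes>\<^bsub>A (cod_of G n)\<^esub> \<sigma> n b = x n \<otimes>\<^bsub>A (cod_of G n)\<^esub> \<sigma> (cod_of G n) b"
        using commutant_coeff(2)[OF x n b] commutative_summand[OF comm e b coeff_closed[OF xc nm]]
        by (simp add: sigma_ident e b)
    qed
    then show False
      using nz by simp
  qed
  then show "x \<in> base_subring A G"
    using xc by (auto simp: base_subring_eq)
next
  fix x assume x: "x \<in> base_subring A G"
  then have x': "x \<in> carrier algebra" "supp x \<subseteq> ob G"
    by (auto simp: base_subring_eq)
  have "x \<otimes>\<^bsub>algebra\<^esub> b = b \<otimes>\<^bsub>algebra\<^esub> x" if b: "b \<in> base_subring A G" for b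
  proof -
    have b': "b \<in> carrier algebra" "supp b \<subseteq> ob G"
      using b by (auto simp: base_subring_eq)
    show ?thesis
    proof (rule algebra_eqI)
      fix n assume n: "n \<in> mor G"
      interpret C: ring "A (cod_of G n)" by (rule ring_cod[OF n])
      have c: "cod_of G n \<in> ob G" "cod_of G n \<in> mor G" "cod_of G (cod_of G n) = cod_of G n"
        using cod_ob[OF n] by (auto simp: ob_in_mor ident_cod)
      have vals: "x n \<in> carrier (A (cod_of G n))" "b n \<in> carrier (A (cod_of G n))"
          "x (cod_of G n) \<in> carrier (A (cod_of G n))" "b (cod_of G n) \<in> carrier (A (cod_of G n))"
        using coeff_closed[OF x'(1)] coeff_closed[OF b'(1)] n c by metis+
      show "(x \<otimes>\<^bsub>algebra\<^esub> b) n = (b \<otimes>\<^bsub>algebra\<^esub> x) n"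
      proof (cases "n \<in> ob G")
        case True
        then show ?thesis
          using n x'(1) b'(1) vals commutative_summand[OF comm c(1)]
          by (simp add: diagonal_mult_coeff[OF x'] diagonal_mult_coeff[OF b'] ident_cod)
      next
        case False
        then have "x n = \<zero>\<^bsub>A (cod_of G n)\<^esub>" "b n = \<zero>\<^bsub>A (cod_of G n)\<^esub>"
          using x' b' n by (auto simp: supp_def)
        then show ?thesis
          using n x'(1) b'(1) vals
          by (simp add: diagonal_mult_coeff[OF x'] diagonal_mult_coeff[OF b'])
      qed
    qed (use x' b' in \<open>auto simp: mult_closed\<close>)
  qed
  then show "x \<in> commutant (base_subring A G) algebra"
    using x' by (simp add: commutant_def)
qed

section \<open>Sufficiency over a groupoid\<close>

lemma inverse_ex:
  assumes "groupoid G" "n \<in> mor G"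
  obtains m where "m \<in> mor G" "dom_of G m = cod_of G n" "cod_of G m = dom_of G n"
    "ccomp G m n = dom_of G n" "ccomp G n m = cod_of G n"
  using assms unfolding groupoid_def by blast

text \<open>
  In a groupoid, composition with \<open>k\<close> can be cancelled, so right multiplication by \<open>u\<^sub>k\<close> moves the
  coefficients at morphisms composable with \<open>k\<close> to distinct places without mixing them.
\<close>
lemma translate_coeff:
  assumes grp: "groupoid G" and x: "x \<in> carrier algebra"
    and mk: "(m, k) \<in> composable G"
  shows "(x \<otimes>\<^bsub>algebra\<^esub> mon \<one>\<^bsub>A (cod_of G k)\<^esub> k) (ccomp G m k) = x m"
proof -
  have m: "m \<in> mor G" and k: "k \<in> mor G" and mk': "dom_of G m = cod_of G k"
    using composableD[OF mk] by auto
  interpret C: ring "A (cod_of G m)" by (rule ring_cod[OF m])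
  interpret D: ring "A (cod_of G k)" by (rule ring_cod[OF k])
  obtain h where h: "h \<in> mor G" "dom_of G h = cod_of G k" "cod_of G h = dom_of G k" "ccomp G k h = cod_of G k"
    using inverse_ex[OF grp k] by metis
  have "(k, h) \<in> composable G"
    using h k by (simp add: composable_def)
  have undo: "ccomp G (ccomp G l k) h = l" if "(l, k) \<in> composable G" for l
    using that comp_assoc[OF that \<open>(k, h) \<in> _\<close>] ident_right[of l] h(4) composableD[OF that] by simp
  have "(x \<otimes>\<^bsub>algebra\<^esub> mon \<one>\<^bsub>A (cod_of G k)\<^esub> k) (ccomp G m k)
      = x m \<otimes>\<^bsub>A (cod_of G m)\<^esub> \<sigma> m (mon \<one>\<^bsub>A (cod_of G k)\<^esub> k k)"
  proof (rule mult_coeff_unique[OF x _ mk refl])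
    show "mon \<one>\<^bsub>A (cod_of G k)\<^esub> k \<in> carrier algebra"
      using k by (simp add: monomial_closed)
    fix m' n' assume *: "(m', n') \<in> composable G" "ccomp G m' n' = ccomp G m k"
      "n' \<in> supp (mon \<one>\<^bsub>A (cod_of G k)\<^esub> k)"
    then have "n' = k"
      using supp_monomial by blast
    then show "m' = m \<and> n' = k"
      using * undo mk by metis
  qed
  then show ?thesis
    using x m k sigma_one[OF mk] by (simp add: monomial_coeff coeff_closed)
qed

text \<open>
  With \<open>k\<close> inverse to \<open>n\<close>, the element \<open>x u\<^sub>k\<close> has at \<open>n k = e\<close> the coefficient \<open>x\<^sub>n\<close>; multiplying by
  \<open>u\<^sub>e\<close> on both sides then discards everything outside \<open>G\<^sub>e\<close>.
\<close>
lemma ideal_meets_vertex: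
  assumes grp: "groupoid G" and I: "two_sided_ideal I algebra" and x: "x \<in> I"
    and n: "n \<in> supp x"
  obtains y where "y \<in> I" "y (cod_of G n) \<noteq> \<zero>\<^bsub>A (cod_of G n)\<^esub>"
    "supp y \<subseteq> mor (vertex_monoid G (cod_of G n))"
proof -
  note ID = two_sided_idealD[OF I abelian_group_algebra]
  have nm: "n \<in> mor G" and nz: "x n \<noteq> \<zero>\<^bsub>A (cod_of G n)\<^esub>"
    using n by (auto simp: supp_def)
  let ?e = "cod_of G n"
  have e: "?e \<in> ob G" using cod_ob[OF nm] .
  have xc: "x \<in> carrier algebra" using x ID(1) by auto
  obtain k where k: "k \<in> mor G" "dom_of G k = cod_of G n" "cod_of G k = dom_of G n" "ccomp G n k = cod_of G n"
    using inverse_ex[OF grp nm] by metis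
  interpret E: ring "A ?e" by (rule ring_A[OF e])
  let ?y = "x \<otimes>\<^bsub>algebra\<^esub> mon \<one>\<^bsub>A (cod_of G k)\<^esub> k"
  have mk: "mon \<one>\<^bsub>A (cod_of G k)\<^esub> k \<in> carrier algebra"
    using k ring_cod[OF k(1)] by (simp add: monomial_closed ring.ring_simprules)
  have y: "?y \<in> I"
    using ID(6)[OF x mk] .
  then have yc: "?y \<in> carrier algebra" using ID(1) by auto
  have "(n, k) \<in> composable G"
    using nm k by (simp add: composable_def)
  then have ye: "?y ?e = x n"
    using translate_coeff[OF grp xc, of n k] k by simp
  let ?z = "(unit_at ?e \<otimes>\<^bsub>algebra\<^esub> ?y) \<otimes>\<^bsub>algebra\<^esub> unit_at ?e"
  have ue: "unit_at ?e \<in> carrier algebra" "supp (unit_at ?e) \<subseteq> ob G"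
    using e supp_monomial[of _ ?e] by (auto simp: unit_at_closed)
  have z: "?z \<in> I"
    using ID(5,6) y ue by simp
  have zp: "?z p = (unit_at ?e (cod_of G p) \<otimes>\<^bsub>A (cod_of G p)\<^esub> ?y p) \<otimes>\<^bsub>A (cod_of G p)\<^esub> \<sigma> p (unit_at ?e (dom_of G p))"
    if "p \<in> mor G" for p
    using that ue yc by (simp add: diagonal_mult_coeff mult_diagonal_coeff mult_closed)
  have "?z ?e = x n"
    using zp[of ?e] e ye coeff_closed[OF xc nm] by (simp add: ob_in_mor ident_cod ident_dom unit_at_coeff sigma_ident)
  moreover have "supp ?z \<subseteq> mor (vertex_monoid G ?e)"
  proof
    fix p assume p: "p \<in> supp ?z"
    then have pm: "p \<in> mor G" by (simp add: supp_def)
    interpret P: ring "A (cod_of G p)" by (rule ring_cod[OF pm])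
    have comp: "(p, dom_of G p) \<in> composable G"
      using pm dom_ob ob_mor by (auto simp: composable_def ident_cod)
    have ob: "cod_of G p \<in> ob G" "dom_of G p \<in> ob G"
      using pm by (auto simp: cod_ob dom_ob)
    have "?z p \<noteq> \<zero>\<^bsub>A (cod_of G p)\<^esub>"
      using p by (simp add: supp_def)
    moreover have "?y p \<in> carrier (A (cod_of G p))"
      by (rule coeff_closed[OF yc pm])
    moreover have "\<sigma> p (unit_at ?e (dom_of G p)) \<in> carrier (A (cod_of G p))"
      using sigma_closed[OF comp] coeff_closed[OF ue(1)] composableD[OF comp] by blast
    moreover have "\<sigma> p \<zero>\<^bsub>A (dom_of G p)\<^esub> = \<zero>\<^bsub>A (cod_of G p)\<^esub>"
      using sigma_zero[OF comp] ob by (simp add: ident_cod)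
    ultimately have "cod_of G p = ?e" "dom_of G p = ?e"
      using pm ob e one_closed_A[OF e]
      by (auto simp: zp monomial_coeff ob_in_mor ident_cod split: if_splits)
    then show "p \<in> mor (vertex_monoid G ?e)"
      using pm by (simp add: vertex_mor)
  qed
  ultimately show ?thesis
    using that[OF z] nz by simp
qed

text \<open>
  The element of smallest support commutes with \<open>A e\<close>: otherwise \<open>a x - x a\<close>, translated by a
  groupoid element so that its coefficient at \<open>e\<close> is nonzero, would be a competitor with smaller
  support. It annihilates the other summands of \<open>A\<close>, as it is supported on \<open>G\<^sub>e\<close>. Maximal
  commutativity then leaves only its coefficient at \<open>e\<close>.
\<close>
lemma ideal_contains_diagonal:
  assumes grp: "groupoid G" and comm: "commutative_ring (direct_sum (ob G) A)"
    and max: "maximal_commutative (base_subring A G) algebra"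
    and I: "two_sided_ideal I algebra" and nz: "I \<noteq> {\<zero>\<^bsub>algebra\<^esub>}"
  obtains e a where "e \<in> ob G" "a \<in> carrier (A e)" "a \<noteq> \<zero>\<^bsub>A e\<^esub>" "mon a e \<in> I"
proof -
  note ID = two_sided_idealD[OF I abelian_group_algebra]
  obtain x0 where x0: "x0 \<in> I" "x0 \<noteq> \<zero>\<^bsub>algebra\<^esub>"
    using nz ID(2) by auto
  then have "\<exists>n\<in>mor G. x0 n \<noteq> \<zero>\<^bsub>algebra\<^esub> n"
    using algebra_eqI[of x0 "\<zero>\<^bsub>algebra\<^esub>"] ID(1) zero_closed by blast
  then obtain n where n: "n \<in> supp x0"
    by (auto simp: supp_def)
  define e where "e = cod_of G n"
  let ?V = "mor (vertex_monoid G e)"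
  have e: "e \<in> ob G"
    using n by (simp add: e_def cod_ob supp_def)
  interpret E: ring "A e" by (rule ring_A[OF e])
  define P where "P y \<longleftrightarrow> y \<in> I \<and> y e \<noteq> \<zero>\<^bsub>A e\<^esub> \<and> supp y \<subseteq> ?V" for y
  obtain y0 where "P y0"
    using ideal_meets_vertex[OF grp I x0(1) n] unfolding P_def e_def by blast
  then obtain x where Px: "P x" and least: "\<And>y. P y \<Longrightarrow> card (supp x) \<le> card (supp y)"
    using ex_has_least_nat[of P y0 "\<lambda>y. card (supp y)"] by blast
  then have x: "x \<in> I" "x e \<noteq> \<zero>\<^bsub>A e\<^esub>" "supp x \<subseteq> ?V"
    by (auto simp: P_def)
  then have xc: "x \<in> carrier algebra" using ID(1) by auto
  have em: "e \<in> mor G" "cod_of G e = e" "dom_of G e = e"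
    using e by (auto simp: ob_in_mor ident_cod ident_dom)
  have xsupp: "e \<in> supp x"
    using x(2) em by (simp add: supp_def)
  have commute: "mon a e \<otimes>\<^bsub>algebra\<^esub> x = x \<otimes>\<^bsub>algebra\<^esub> mon a e" if a: "a \<in> carrier (A e)" for a
  proof -
    have ac: "mon a e \<in> carrier algebra" "supp (mon a e) \<subseteq> ob G"
      using base_monomial[OF e a] by (auto simp: base_subring_eq)
    define y where "y = mon a e \<otimes>\<^bsub>algebra\<^esub> x \<oplus>\<^bsub>algebra\<^esub> \<ominus>\<^bsub>algebra\<^esub> (x \<otimes>\<^bsub>algebra\<^esub> mon a e)"
    have y: "y \<in> I"
      unfolding y_def using ID(3-6) x(1) ac(1) by simp
    then have yc: "y \<in> carrier algebra" using ID(1) by auto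
    have yp: "y p = mon a e (cod_of G p) \<otimes>\<^bsub>A (cod_of G p)\<^esub> x p
        \<oplus>\<^bsub>A (cod_of G p)\<^esub> \<ominus>\<^bsub>A (cod_of G p)\<^esub> (x p \<otimes>\<^bsub>A (cod_of G p)\<^esub> \<sigma> p (mon a e (dom_of G p)))"
      if "p \<in> mor G" for p
      using that ac xc unfolding y_def
      by (simp add: diagonal_mult_coeff mult_diagonal_coeff mult_closed)
    \<comment> \<open>Here commutativity of \<open>A e\<close> and \<open>\<sigma>\<^sub>e = id\<close> remove \<open>e\<close> from the support.\<close>
    have "y e = \<zero>\<^bsub>A e\<^esub>"
      using yp[OF em(1)] em a commutative_summand[OF comm e a coeff_closed[OF xc em(1), unfolded em]]
        coeff_closed[OF xc em(1)]
      by (simp add: monomial_coeff sigma_ident[OF e] E.r_neg)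
    moreover have "supp y \<subseteq> supp x"
    proof
      fix p assume p: "p \<in> supp y"
      then have pm: "p \<in> mor G" "y p \<noteq> \<zero>\<^bsub>A (cod_of G p)\<^esub>" by (auto simp: supp_def)
      interpret P: ring "A (cod_of G p)" by (rule ring_cod[OF pm(1)])
      have comp: "(p, dom_of G p) \<in> composable G"
        using pm dom_ob ob_mor by (auto simp: composable_def ident_cod)
      have "\<sigma> p (mon a e (dom_of G p)) \<in> carrier (A (cod_of G p))"
        using sigma_closed[OF comp] coeff_closed[OF ac(1)] composableD[OF comp] by blast
      moreover have "mon a e (cod_of G p) \<in> carrier (A (cod_of G p))"
        using coeff_closed[OF ac(1), of "cod_of G p"] cod_ob[OF pm(1)] by (simp add: ob_in_mor ident_cod)
      ultimately show "p \<in> supp x"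
        using pm yp[OF pm(1)] by (auto simp: supp_def)
    qed
    moreover have "e \<notin> supp y"
      using calculation(1) em by (simp add: supp_def)
    ultimately have sub: "supp y \<subset> supp x"
      using xsupp by blast
    have "supp y = {}"
    proof (rule ccontr)
      assume "supp y \<noteq> {}"
      then obtain p where p: "p \<in> supp y" by auto
      then have pV: "p \<in> ?V" using sub x(3) by auto
      then have pm: "p \<in> mor G" "dom_of G p = e" "cod_of G p = e"
        by (auto simp: vertex_mor)
      obtain k where k: "k \<in> mor G" "dom_of G k = e" "cod_of G k = e" "ccomp G p k = e"
        using inverse_ex[OF grp pm(1)] pm by metis
      let ?z = "y \<otimes>\<^bsub>algebra\<^esub> mon \<one>\<^bsub>A (cod_of G k)\<^esub> k"
      have kc: "mon \<one>\<^bsub>A (cod_of G k)\<^esub> k \<in> carrier algebra"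
        using k by (simp add: monomial_closed)
      have "(p, k) \<in> composable G"
        using pm k by (simp add: composable_def)
      then have ze: "?z e \<noteq> \<zero>\<^bsub>A e\<^esub>"
        using translate_coeff[OF grp yc, of p k] k p pm by (simp add: supp_def)
      \<comment> \<open>Translation by \<open>k\<close> stays inside \<open>G\<^sub>e\<close> and does not enlarge the support.\<close>
      have sz: "supp ?z \<subseteq> (\<lambda>m. ccomp G m k) ` supp y"
        using supp_mult[of y] supp_monomial by fast
      moreover have "(\<lambda>m. ccomp G m k) ` supp y \<subseteq> ?V"
      proof (intro image_subsetI)
        fix m assume "m \<in> supp y"
        then have "m \<in> ?V" using sub x(3) by auto
        then have "(m, k) \<in> composable G" "cod_of G m = e"
          using k by (auto simp: composable_def vertex_mor)
        then show "ccomp G m k \<in> ?V"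
          using k by (simp add: vertex_mor comp_mor dom_comp cod_comp)
      qed
      ultimately have "P ?z"
        using ID(6)[OF y kc] ze by (auto simp: P_def)
      then have "card (supp x) \<le> card (supp ?z)"
        by (rule least)
      also have "\<dots> \<le> card (supp y)"
        using sz finite_supp[OF yc] by (meson card_image_le card_mono finite_imageI le_trans)
      also have "\<dots> < card (supp x)"
        using sub finite_supp[OF xc] by (simp add: psubset_card_mono)
      finally show False by simp
    qed
    then have "y = \<zero>\<^bsub>algebra\<^esub>"
      using yc by (intro algebra_eqI zero_closed) (auto simp: supp_def)
    then show ?thesis
      using ac(1) xc alg.minus_equality unfolding y_def
      by (metis alg.minus_minus alg.a_inv_closed mult_closed)
  qed
  have "x \<otimes>\<^bsub>algebra\<^esub> b = b \<otimes>\<^bsub>algebra\<^esub> x" if b: "b \<in> base_subring A G" for b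
  proof -
    have b': "b \<in> carrier algebra" "supp b \<subseteq> ob G"
      using b by (auto simp: base_subring_eq)
    have be: "b e \<in> carrier (A e)"
      using coeff_closed[OF b'(1) em(1)] em by simp
    have ac: "mon (b e) e \<in> carrier algebra" "supp (mon (b e) e) \<subseteq> ob G"
      using base_monomial[OF e be] by (auto simp: base_subring_eq)
    show ?thesis
    proof (rule algebra_eqI)
      fix p assume p: "p \<in> mor G"
      interpret P: ring "A (cod_of G p)" by (rule ring_cod[OF p])
      show "(x \<otimes>\<^bsub>algebra\<^esub> b) p = (b \<otimes>\<^bsub>algebra\<^esub> x) p"
      proof (cases "p \<in> ?V")
        case True
        then have "cod_of G p = e" "dom_of G p = e"
          by (auto simp: vertex_mor)
        then show ?thesis
          using fun_cong[OF commute[OF be], of p] p ac b' xc em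
          by (simp add: diagonal_mult_coeff mult_diagonal_coeff monomial_coeff)
      next
        case False
        then have "x p = \<zero>\<^bsub>A (cod_of G p)\<^esub>"
          using x(3) p by (auto simp: supp_def)
        moreover have "b (cod_of G p) \<in> carrier (A (cod_of G p))"
          using coeff_closed[OF b'(1), of "cod_of G p"] cod_ob[OF p] by (simp add: ob_in_mor ident_cod)
        moreover have "\<sigma> p (b (dom_of G p)) \<in> carrier (A (cod_of G p))"
          using sigma_closed[of p "dom_of G p"] coeff_closed[OF b'(1), of "dom_of G p"] p dom_ob[OF p]
          by (simp add: composable_def ob_in_mor ident_cod)
        ultimately show ?thesis
          using p b' xc by (simp add: diagonal_mult_coeff mult_diagonal_coeff)
      qed
    qed (use b' xc in \<open>auto simp: mult_closed\<close>)
  qed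
  then have "x \<in> base_subring A G"
    using max xc unfolding maximal_commutative_def commutant_def by blast
  then have diag: "supp x \<subseteq> ob G"
    by (simp add: base_subring_eq)
  have xe: "x e \<in> carrier (A e)"
    using coeff_closed[OF xc em(1)] em by simp
  have "x = mon (x e) e"
  proof (rule algebra_eqI[OF xc])
    show "mon (x e) e \<in> carrier algebra"
      using base_monomial[OF e xe] by (simp add: base_subring_eq)
    fix p assume p: "p \<in> mor G"
    have "p = e" if "p \<in> supp x"
    proof -
      have "p \<in> ob G" "p \<in> ?V"
        using that diag x(3) by auto
      then show ?thesis
        using ident_cod by (auto simp: vertex_mor)
    qed
    then have "x p = \<zero>\<^bsub>A (cod_of G p)\<^esub>" if "p \<noteq> e"
      using that p unfolding supp_def by blast
    then show "x p = mon (x e) e p"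
      using p by (cases "p = e") (simp_all add: monomial_coeff)
  qed
  then show ?thesis
    using that[OF e xe x(2)] x(1) by simp
qed

text \<open>
  The coefficients \<open>b\<close> with \<open>b u\<^sub>e\<close> in a nonzero ideal form an ideal of \<open>A e\<close>, invariant under \<open>G\<^sub>e\<close>
  because \<open>u\<^sub>n (b u\<^sub>e) u\<^sub>k = \<sigma>\<^sub>n(b) u\<^sub>e\<close> for \<open>k\<close> inverse to \<open>n\<close>. For some \<open>e\<close> it is nonzero, hence equal
  to \<open>A e\<close>. So the original ideal contains \<open>u\<^sub>e\<close>, and therefore
  \<open>u\<^sub>f = u\<^sub>m u\<^sub>e u\<^sub>n\<close> whenever \<open>f = m n\<close> factors through \<open>e\<close>.
\<close>
lemma groupoid_imp_simple:
  assumes grp: "groupoid G" and comm: "commutative_ring (direct_sum (ob G) A)"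
    and conn: "inverse_connected G" and vertex: "\<And>e. e \<in> ob G \<Longrightarrow> vertex_simple A G \<sigma> e"
    and max: "maximal_commutative (base_subring A G) algebra"
  shows "simple_ring algebra"
  unfolding simple_ring_def
proof
  assume "\<exists>I. nontrivial_ideal I algebra"
  then obtain I where I: "two_sided_ideal I algebra" "I \<noteq> carrier algebra" "I \<noteq> {\<zero>\<^bsub>algebra\<^esub>}"
    by (auto simp: nontrivial_ideal_def)
  note ID = two_sided_idealD[OF I(1) abelian_group_algebra]
  obtain e a where e: "e \<in> ob G" and a: "a \<in> carrier (A e)" "a \<noteq> \<zero>\<^bsub>A e\<^esub>" "mon a e \<in> I"
    using ideal_contains_diagonal[OF grp comm max I(1,3)] by metis
  interpret E: ring "A e" by (rule ring_A[OF e])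
  have em: "e \<in> mor G" "cod_of G e = e" "dom_of G e = e"
    using e by (auto simp: ob_in_mor ident_cod ident_dom)
  have mc: "mon b e \<in> carrier algebra" if "b \<in> carrier (A e)" for b
    using that em by (simp add: monomial_closed)
  have mult: "mon (b \<otimes>\<^bsub>A e\<^esub> c) e = mon b e \<otimes>\<^bsub>algebra\<^esub> mon c e"
    if "b \<in> carrier (A e)" "c \<in> carrier (A e)" for b c
    using that em e by (simp add: monomial_mult ident_composable ident_comp sigma_ident)
  define J where "J = {b \<in> carrier (A e). mon b e \<in> I}"
  have "two_sided_ideal J (A e)"
    unfolding two_sided_ideal_def
  proof (intro conjI ballI E.additive_subgroupI_closed)
    have "mon \<zero>\<^bsub>A e\<^esub> e = \<zero>\<^bsub>algebra\<^esub>"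
      using mc em by (intro algebra_eqI zero_closed) (auto simp: monomial_coeff)
    then show "\<zero>\<^bsub>A e\<^esub> \<in> J"
      using ID(2) by (simp add: J_def)
    show "b \<oplus>\<^bsub>A e\<^esub> c \<in> J" if "b \<in> J" "c \<in> J" for b c
    proof -
      have bc: "b \<in> carrier (A e)" "c \<in> carrier (A e)" "mon b e \<in> I" "mon c e \<in> I"
        using that by (auto simp: J_def)
      have "mon (b \<oplus>\<^bsub>A e\<^esub> c) e = mon b e \<oplus>\<^bsub>algebra\<^esub> mon c e"
        using bc mc em
        by (intro algebra_eqI add_closed) (auto simp: monomial_coeff ring_cod ring.ring_simprules)
      then show ?thesis
        using bc ID(3) by (simp add: J_def)
    qed
    show "\<ominus>\<^bsub>A e\<^esub> b \<in> J" if "b \<in> J" for b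
    proof -
      have b: "b \<in> carrier (A e)" "mon b e \<in> I"
        using that by (auto simp: J_def)
      have "mon (\<ominus>\<^bsub>A e\<^esub> b) e = \<ominus>\<^bsub>algebra\<^esub> mon b e"
      proof (rule algebra_eqI)
        fix p assume p: "p \<in> mor G"
        interpret P: ring "A (cod_of G p)" by (rule ring_cod[OF p])
        show "mon (\<ominus>\<^bsub>A e\<^esub> b) e p = (\<ominus>\<^bsub>algebra\<^esub> mon b e) p"
          using p b mc em by (simp add: monomial_coeff)
      qed (use b mc in auto)
      then show ?thesis
        using b ID(4) by (simp add: J_def)
    qed
    fix b c assume "b \<in> J" "c \<in> carrier (A e)"
    then show "c \<otimes>\<^bsub>A e\<^esub> b \<in> J" "b \<otimes>\<^bsub>A e\<^esub> c \<in> J"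
      using ID(5,6) mc by (auto simp: J_def mult)
  qed (auto simp: J_def)
  moreover have "\<sigma> n ` J \<subseteq> J" if n: "n \<in> mor (vertex_monoid G e)" for n
  proof
    fix c assume "c \<in> \<sigma> n ` J"
    then obtain b where b: "b \<in> carrier (A e)" "mon b e \<in> I" "c = \<sigma> n b"
      by (auto simp: J_def)
    have nm: "n \<in> mor G" "dom_of G n = e" "cod_of G n = e"
      using n by (auto simp: vertex_mor)
    obtain k where k: "k \<in> mor G" "dom_of G k = e" "cod_of G k = e" "ccomp G n k = e"
      using inverse_ex[OF grp nm(1)] nm by metis
    have comp: "(n, e) \<in> composable G" "(e, k) \<in> composable G"
      using nm k em by (auto simp: composable_def)
    have c: "c \<in> carrier (A e)"
      using sigma_closed[OF comp(1)] b nm em by simp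
    have "(mon \<one>\<^bsub>A e\<^esub> n \<otimes>\<^bsub>algebra\<^esub> mon b e) \<otimes>\<^bsub>algebra\<^esub> mon \<one>\<^bsub>A e\<^esub> k = mon c e"
      using nm k em comp b c e ident_left[OF k(1)]
      by (simp add: monomial_mult3 sigma_ident)
    moreover have "mon \<one>\<^bsub>A e\<^esub> n \<in> carrier algebra" "mon \<one>\<^bsub>A e\<^esub> k \<in> carrier algebra"
      using nm k by (simp_all add: monomial_closed)
    ultimately have "mon c e \<in> I"
      using ID(5,6) b(2) by metis
    then show "c \<in> J"
      using c by (simp add: J_def)
  qed
  moreover have "J \<noteq> {\<zero>\<^bsub>A e\<^esub>}"
    using a by (auto simp: J_def)
  ultimately have "J = carrier (A e)"
    using vertex[OF e] unfolding vertex_simple_def nontrivial_ideal_def by blast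
  then have ue: "unit_at e \<in> I"
    using E.one_closed by (auto simp: J_def)
  have units: "unit_at f \<in> I" if f: "f \<in> ob G" for f
  proof -
    obtain m n where mn: "m \<in> mor G" "n \<in> mor G" "dom_of G m = e" "cod_of G n = e" "ccomp G m n = f"
      using conn f e unfolding inverse_connected_def by blast
    interpret F: ring "A f" by (rule ring_A[OF f])
    have comp: "(m, e) \<in> composable G" "(e, n) \<in> composable G" "(m, n) \<in> composable G"
      using mn em by (auto simp: composable_def)
    have cm: "cod_of G m = f"
      using cod_comp[OF comp(3)] mn f by (simp add: ident_cod)
    have "(mon \<one>\<^bsub>A f\<^esub> m \<otimes>\<^bsub>algebra\<^esub> unit_at e) \<otimes>\<^bsub>algebra\<^esub> mon \<one>\<^bsub>A e\<^esub> n = unit_at f"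
      using mn em comp e cm ident_left[OF mn(2)] sigma_one[OF comp(1)]
      by (simp add: monomial_mult3 sigma_ident)
    moreover have "mon \<one>\<^bsub>A f\<^esub> m \<in> carrier algebra" "mon \<one>\<^bsub>A e\<^esub> n \<in> carrier algebra"
      using mn cm by (simp_all add: monomial_closed)
    ultimately show ?thesis
      using ID(5,6) ue by metis
  qed
  have "x \<in> I" if "x \<in> carrier algebra" for x
    using that
  proof (induction rule: algebra_induct)
    case zero
    show ?case by (rule ID(2))
  next
    case (add n b x)
    interpret C: ring "A (cod_of G n)" by (rule ring_cod[OF add(1)])
    have c: "cod_of G n \<in> ob G" "(cod_of G n, n) \<in> composable G"
      using add cod_ob ob_mor by (auto simp: composable_def ident_dom)
    have "unit_at (cod_of G n) \<otimes>\<^bsub>algebra\<^esub> mon b n = mon b n"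
      using add c by (simp add: monomial_mult ob_in_mor ident_cod sigma_ident ident_left)
    then have "mon b n \<in> I"
      using ID(6)[OF units[OF c(1)] monomial_closed[OF add(1,2)]] by simp
    then show ?case
      using ID(3) add by simp
  qed
  then show False
    using I(2) ID(1) by blast
qed

end

theorem proposition14:
  fixes A :: "'m \<Rightarrow> ('a, 'r) ring_scheme"
    and G :: "'m category"
    and \<sigma> :: "'m \<Rightarrow> 'a \<Rightarrow> 'a"
  assumes "skew_category_system A G \<sigma>"
    and "commutative_ring (direct_sum (ob G) A)"
  shows "(simple_ring (skew_category_algebra A G \<sigma>) \<longrightarrow>
        inverse_connected G
      \<and> (\<forall>e\<in>ob G. vertex_simple A G \<sigma> e)
      \<and> (\<forall>e\<in>ob G. field (center_ring (skew_category_algebra A (vertex_monoid G e) \<sigma>)))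
      \<and> kernel_locally_trivial A G \<sigma>
      \<and> maximal_commutative (base_subring A G) (skew_category_algebra A G \<sigma>))
    \<and> (groupoid G \<longrightarrow>
        (simple_ring (skew_category_algebra A G \<sigma>) \<longleftrightarrow>
          inverse_connected G
        \<and> (\<forall>e\<in>ob G. vertex_simple A G \<sigma> e)
        \<and> (\<forall>e\<in>ob G. field (center_ring (skew_category_algebra A (vertex_monoid G e) \<sigma>)))
        \<and> kernel_locally_trivial A G \<sigma>
        \<and> maximal_commutative (base_subring A G) (skew_category_algebra A G \<sigma>)))"
proof -
  interpret skew_category_system A G \<sigma> by (rule assms(1))
  note comm = assms(2)
  have necessary: "inverse_connected G
      \<and> (\<forall>e\<in>ob G. vertex_simple A G \<sigma> e)
      \<and> (\<forall>e\<in>ob G. field (center_ring (corner e)))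
      \<and> kernel_locally_trivial A G \<sigma>
      \<and> maximal_commutative (base_subring A G) algebra" if "simple_ring algebra"
    using that simple_imp_inverse_connected simple_imp_vertex_simple simple_imp_center_field
      simple_imp_kernel_locally_trivial simple_imp_maximal_commutative[OF _ comm] by blast
  then show ?thesis
    using groupoid_imp_simple[OF _ comm] by blast
qed

end
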